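(* Let $\varphi$ be a formula of $\mathcal{DTL}$ and let $\mathfrak M=\langle X,\mathcal T,f,V\rangle$ be a dynamic topological model satisfying $\varphi$ (i.e. $V(\varphi)\neq\varnothing$). Let $\chi^\ast\subseteq I_\omega(\varphi)\times X$ be the unique maximal simulation (with respect to inclusion) and let $\mathrm{dom}(\chi^\ast)=\{\mathfrak a\in I_\omega(\varphi):\chi^\ast(\mathfrak a)\ne\varnothing\}$. Then the structure $\mathfrak M/\varphi$ obtained by restricting $\langle I_\omega(\varphi),\succeq,\rightrightarrows,t\rangle$ to $\mathrm{dom}(\chi^\ast)$ is a $\varphi$-typed non-deterministic quasimodel (with accessibility relation $\succeq$, transition relation $\rightrightarrows$ and type function $t$), and it satisfies $\varphi$.
   Context: Language and models. Formulas of $\mathcal{DTL}$ are built from propositional variables with $\wedge,\neg$ and unary modalities $\Box,\bigcirc,\ast$; $\Diamond=\neg\Box\neg$. A dynamic topological model is $\langle X,\mathcal T,f,V\rangle$ with $\langle X,\mathcal T\rangle$ a topological space, $f:X\to X$ continuous, $V$ assigning subsets of $X$ to variables, extended by $V(\alpha\wedge\beta)=V(\alpha)\cap V(\beta)$, $V(\neg\alpha)=X\setminus V(\alpha)$, $V(\Box\alpha)=V(\alpha)^\circ$ (interior), $V(\bigcirc\alpha)=f^{-1}(V(\alpha))$, $V(\ast\alpha)=\bigcap_{n\ge0}f^{-n}(V(\alpha))$. Types and frames. $\mathrm{sub}(\varphi)$ is the set of subformulas of $\varphi$ and $\mathrm{sub}_\pm(\varphi)=\mathrm{sub}(\varphi)\cup\{\neg\psi:\psi\in\mathrm{sub}(\varphi)\}$,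 where $\psi$ and $\neg\neg\psi$ are identified. A $\varphi$-type is a set $\mathbf t\subseteq\mathrm{sub}_\pm(\varphi)$ such that for all $\psi\in\mathrm{sub}_\pm(\varphi)$, $\psi\notin\mathbf t\Leftrightarrow\neg\psi\in\mathbf t$, and for all $\psi_1\wedge\psi_2\in\mathrm{sub}_\pm(\varphi)$, $\psi_1\wedge\psi_2\in\mathbf t\Leftrightarrow\psi_1,\psi_2\in\mathbf t$. A $\varphi$-typed Kripke frame is $\langle W,R,t\rangle$ with $R$ a transitive reflexive relation on $W$ and $t$ assigning a $\varphi$-type to each $w\in W$ such that (for $\Box\psi\in\mathrm{sub}_\pm(\varphi)$) $\Box\psi\in t(w)\Leftrightarrow\forall v(Rwv\Rightarrow\psi\in t(v))$. $W$ carries the topology whose open sets are the sets upward closed under $R$. A relation between topological spaces is continuous if the preimage of every open set is open. Sensible relations and quasimodels. A pair $(\mathbf t,\mathbf s)$ of $\varphi$-types is sensible if for all $\bigcirc\psi\in\mathrm{sub}(\varphi)$, $\bigcirc\psi\in\mathbf t\Leftrightarrow\psi\in\mathbf s$, and for all $\ast\psi\in\mathrm{sub}(\varphi)$, $\ast\psi\in\mathbf t\Leftrightarrow(\psi\in\mathbf t$ and $\ast\psi\in\mathbf s)$. A pair of worlds is sensible if the pair of their types is. A relation $g$ between (the worlds of) $\varphi$-typed Kripke frames is sensible if it is continuous, $g(w)\ne\varnothing$ for every world $w$ of the source frame, and every pair in $g$ is sensible. A sensible $g\subseteq W\times W$ is $\omega$-sensible if for all $\ast\psi\in\mathrm{sub}(\varphi)$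 and $w\in W$: $\neg\ast\psi\in t(w)$ iff there are $v\in W$, $N\ge0$ with $g^Nwv$ and $\neg\psi\in t(v)$. A $\varphi$-typed non-deterministic quasimodel is $\langle W,R,t,g\rangle$ with $\langle W,R,t\rangle$ a $\varphi$-typed Kripke frame and $g$ an $\omega$-sensible relation on $W$; it satisfies $\varphi$ if $\varphi\in t(w)$ for some $w\in W$. The structure $I_\omega(\varphi)$. A local ($\varphi$-typed) Kripke frame is $\mathfrak a=\langle w_{\mathfrak a},W_{\mathfrak a},R_{\mathfrak a},t_{\mathfrak a}\rangle$ where $\langle W_{\mathfrak a},R_{\mathfrak a},t_{\mathfrak a}\rangle$ is a $\varphi$-typed Kripke frame and $R_{\mathfrak a}w_{\mathfrak a}v$ for all $v\in W_{\mathfrak a}$. It is tree-like if the partial order induced by $R_{\mathfrak a}$ on clusters (classes of $w\sim v\Leftrightarrow Rwv\ \&\ Rvw$) is a tree: if $R[u][w]$ and $R[v][w]$ then $R[u][v]$ or $R[v][u]$. Write $t(\mathfrak a)=t_{\mathfrak a}(w_{\mathfrak a})$. $I_\omega(\varphi)$ is the set of all finite tree-like local $\varphi$-typed Kripke frames (up to isomorphism preserving root, relation and types). For $v\in W_{\mathfrak a}$, $\mathfrak a^v$ is the local frame with root $v$ obtained by restricting $\mathfrak a$ to $\{w:R_{\mathfrak a}vw\}$; $\mathfrak b\preceq\mathfrak a$ (equivalently $\mathfrak a\succeq\mathfrak b$) means $\mathfrak b=\mathfrak a^v$ for some $v$. $\mathfrak a\rightrightarrows\mathfrak b$ means there is a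 sensible relation $g\subseteq W_{\mathfrak a}\times W_{\mathfrak b}$ with $g w_{\mathfrak a}w_{\mathfrak b}$ which is non-confluent: whenever $gwv$, $gw'v'$ and $R_{\mathfrak b}vv'$, then $R_{\mathfrak a}ww'$. $I_\omega(\varphi)$ is a $\varphi$-typed Kripke frame with accessibility $\succeq$ (so open sets are those closed under taking subframes $\preceq$) and type function $t$. Simulations. For $x\in X$, $\tau(x)=\{\psi\in\mathrm{sub}_\pm(\varphi):x\in V(\psi)\}$. A simulation from a $\varphi$-typed Kripke frame $\langle W,R,t\rangle$ to $\mathfrak M$ is a continuous relation $\chi\subseteq W\times X$ (preimages of open subsets of $X$ are open in $W$) such that $x\in\chi(w)$ implies $\tau(x)=t(w)$. For every $\mathfrak M$ there is a unique maximal simulation $\chi^\ast\subseteq I_\omega(\varphi)\times X$. *)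

theory Defs
  imports "HOL-Analysis.Abstract_Topology"
begin

datatype 'p fm =
    Var 'p
  | And "'p fm" "'p fm"
  | Neg "'p fm"
  | Box "'p fm"
  | Next "'p fm"
  | Star "'p fm"

record ('x, 'p) dtmodel =
  mtop :: "'x topology"
  mfun :: "'x \<Rightarrow> 'x"
  mval :: "'p \<Rightarrow> 'x set"

definition dyn_top_model :: "('x, 'p) dtmodel \<Rightarrow> bool" where
  "dyn_top_model M \<longleftrightarrow>
     continuous_map (mtop M) (mtop M) (mfun M) \<and> (\<forall>p. mval M p \<subseteq> topspace (mtop M))"

fun truth_set :: "('x, 'p) dtmodel \<Rightarrow> 'p fm \<Rightarrow> 'x set" where
  "truth_set M (Var p) = mval M p"
| "truth_set M (And \<alpha> \<beta>) = truth_set M \<alpha> \<inter> truth_set M \<beta>"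
| "truth_set M (Neg \<alpha>) = topspace (mtop M) - truth_set M \<alpha>"
| "truth_set M (Box \<alpha>) = mtop M interior_of truth_set M \<alpha>"
| "truth_set M (Next \<alpha>) = {x \<in> topspace (mtop M). mfun M x \<in> truth_set M \<alpha>}"
| "truth_set M (Star \<alpha>) = {x \<in> topspace (mtop M). \<forall>n. (mfun M ^^ n) x \<in> truth_set M \<alpha>}"

fun subfms :: "'p fm \<Rightarrow> 'p fm set" where
  "subfms (Var p) = {Var p}"
| "subfms (And \<alpha> \<beta>) = insert (And \<alpha> \<beta>) (subfms \<alpha> \<union> subfms \<beta>)"
| "subfms (Neg \<alpha>) = insert (Neg \<alpha>) (subfms \<alpha>)"
| "subfms (Box \<alpha>) = insert (Box \<alpha>) (subfms \<alpha>)"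
| "subfms (Next \<alpha>) = insert (Next \<alpha>) (subfms \<alpha>)"
| "subfms (Star \<alpha>) = insert (Star \<alpha>) (subfms \<alpha>)"

text \<open>
  The identification of \<open>\<psi>\<close> with \<open>\<not>\<not>\<psi>\<close> is rendered by a negation that removes an outermost
  \<open>\<not>\<close> instead of adding a second one. Every negation occurring in the definitions of
  signed subformulas, types and \<open>\<omega>\<close>-sensible relations is this one.
\<close>

fun neg :: "'p fm \<Rightarrow> 'p fm" where
  "neg (Neg \<psi>) = \<psi>"
| "neg \<psi> = Neg \<psi>"

definition subpm :: "'p fm \<Rightarrow> 'p fm set" where
  "subpm \<phi> = subfms \<phi> \<union> neg ` subfms \<phi>"

definition is_type :: "'p fm \<Rightarrow> 'p fm set \<Rightarrow> bool" where
  "is_type \<phi> s \<longleftrightarrow>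
     s \<subseteq> subpm \<phi> \<and>
     (\<forall>\<psi> \<in> subpm \<phi>. \<psi> \<notin> s \<longleftrightarrow> neg \<psi> \<in> s) \<and>
     (\<forall>\<psi>1 \<psi>2. And \<psi>1 \<psi>2 \<in> subpm \<phi> \<longrightarrow> (And \<psi>1 \<psi>2 \<in> s \<longleftrightarrow> \<psi>1 \<in> s \<and> \<psi>2 \<in> s))"

record ('w, 'p) tframe =
  worlds :: "'w set"
  access :: "('w \<times> 'w) set"
  tp :: "'w \<Rightarrow> 'p fm set"

definition typed_frame :: "'p fm \<Rightarrow> ('w, 'p, 'z) tframe_scheme \<Rightarrow> bool" where
  "typed_frame \<phi> F \<longleftrightarrow>
     access F \<subseteq> worlds F \<times> worlds F \<and> refl_on (worlds F) (access F) \<and> trans (access F) \<and>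
     (\<forall>w \<in> worlds F. is_type \<phi> (tp F w)) \<and>
     (\<forall>w \<in> worlds F. \<forall>\<psi>. Box \<psi> \<in> subpm \<phi> \<longrightarrow>
        (Box \<psi> \<in> tp F w \<longleftrightarrow> (\<forall>v. (w, v) \<in> access F \<longrightarrow> \<psi> \<in> tp F v)))"

definition up_topology :: "('w, 'p, 'z) tframe_scheme \<Rightarrow> 'w topology" where
  "up_topology F =
     topology (\<lambda>U. U \<subseteq> worlds F \<and> (\<forall>u \<in> U. \<forall>v \<in> worlds F. (u, v) \<in> access F \<longrightarrow> v \<in> U))"

lemma openin_up_topology:
  "openin (up_topology F) U \<longleftrightarrow>
     U \<subseteq> worlds F \<and> (\<forall>u \<in> U. \<forall>v \<in> worlds F. (u, v) \<in> access F \<longrightarrow> v \<in> U)"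
proof -
  have "istopology (\<lambda>U. U \<subseteq> worlds F \<and> (\<forall>u \<in> U. \<forall>v \<in> worlds F. (u, v) \<in> access F \<longrightarrow> v \<in> U))"
    unfolding istopology_def by blast
  then show ?thesis
    unfolding up_topology_def by (simp add: topology_inverse')
qed

lemma topspace_up_topology: "topspace (up_topology F) = worlds F"
  unfolding topspace_def openin_up_topology by blast

definition continuous_rel :: "'a topology \<Rightarrow> 'b topology \<Rightarrow> ('a \<times> 'b) set \<Rightarrow> bool" where
  "continuous_rel S T g \<longleftrightarrow>
     g \<subseteq> topspace S \<times> topspace T \<and> (\<forall>U. openin T U \<longrightarrow> openin S (g\<inverse> `` U))"

definition sensible_pair :: "'p fm \<Rightarrow> 'p fm set \<Rightarrow> 'p fm set \<Rightarrow> bool" where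
  "sensible_pair \<phi> t s \<longleftrightarrow>
     (\<forall>\<psi>. Next \<psi> \<in> subfms \<phi> \<longrightarrow> (Next \<psi> \<in> t \<longleftrightarrow> \<psi> \<in> s)) \<and>
     (\<forall>\<psi>. Star \<psi> \<in> subfms \<phi> \<longrightarrow> (Star \<psi> \<in> t \<longleftrightarrow> \<psi> \<in> t \<and> Star \<psi> \<in> s))"

definition sensible ::
  "'p fm \<Rightarrow> ('w, 'p, 'y) tframe_scheme \<Rightarrow> ('v, 'p, 'z) tframe_scheme \<Rightarrow> ('w \<times> 'v) set \<Rightarrow> bool" where
  "sensible \<phi> F G g \<longleftrightarrow>
     continuous_rel (up_topology F) (up_topology G) g \<and>
     (\<forall>w \<in> worlds F. g `` {w} \<noteq> {}) \<and>
     (\<forall>(w, v) \<in> g. sensible_pair \<phi> (tp F w) (tp G v))"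

definition omega_sensible :: "'p fm \<Rightarrow> ('w, 'p, 'z) tframe_scheme \<Rightarrow> ('w \<times> 'w) set \<Rightarrow> bool" where
  "omega_sensible \<phi> F g \<longleftrightarrow>
     sensible \<phi> F F g \<and>
     (\<forall>\<psi>. Star \<psi> \<in> subfms \<phi> \<longrightarrow> (\<forall>w \<in> worlds F.
        neg (Star \<psi>) \<in> tp F w \<longleftrightarrow>
          (\<exists>v \<in> worlds F. \<exists>N. (w, v) \<in> g ^^ N \<and> neg \<psi> \<in> tp F v)))"

record ('w, 'p) qmodel = "('w, 'p) tframe" +
  transit :: "('w \<times> 'w) set"

definition quasimodel :: "'p fm \<Rightarrow> ('w, 'p) qmodel \<Rightarrow> bool" where
  "quasimodel \<phi> Q \<longleftrightarrow> typed_frame \<phi> Q \<and> omega_sensible \<phi> Q (transit Q)"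

definition satisfied_in :: "'p fm \<Rightarrow> ('w, 'p) qmodel \<Rightarrow> bool" where
  "satisfied_in \<phi> Q \<longleftrightarrow> (\<exists>w \<in> worlds Q. \<phi> \<in> tp Q w)"

record ('w, 'p) lframe = "('w, 'p) tframe" +
  rt :: 'w

definition local_frame :: "'p fm \<Rightarrow> ('w, 'p) lframe \<Rightarrow> bool" where
  "local_frame \<phi> a \<longleftrightarrow>
     typed_frame \<phi> a \<and> rt a \<in> worlds a \<and> (\<forall>v \<in> worlds a. (rt a, v) \<in> access a)"

definition clusters :: "('w, 'p, 'z) tframe_scheme \<Rightarrow> 'w set set" where
  "clusters F = worlds F // {(w, v). (w, v) \<in> access F \<and> (v, w) \<in> access F}"

definition cluster_le :: "('w, 'p, 'z) tframe_scheme \<Rightarrow> 'w set \<Rightarrow> 'w set \<Rightarrow> bool" where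
  "cluster_le F C D \<longleftrightarrow> (\<exists>w \<in> C. \<exists>v \<in> D. (w, v) \<in> access F)"

definition tree_like :: "('w, 'p, 'z) tframe_scheme \<Rightarrow> bool" where
  "tree_like F \<longleftrightarrow>
     (\<forall>C \<in> clusters F. \<forall>D \<in> clusters F. \<forall>E \<in> clusters F.
        cluster_le F C E \<and> cluster_le F D E \<longrightarrow> cluster_le F C D \<or> cluster_le F D C)"

definition restrict_at :: "('w, 'p) lframe \<Rightarrow> 'w \<Rightarrow> ('w, 'p) lframe" where
  "restrict_at a v =
     (let U = {w \<in> worlds a. (v, w) \<in> access a}
      in \<lparr>worlds = U, access = access a \<inter> U \<times> U, tp = tp a, rt = v\<rparr>)"

definition arrows :: "'p fm \<Rightarrow> ('w, 'p) lframe \<Rightarrow> ('v, 'p) lframe \<Rightarrow> bool" where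
  "arrows \<phi> a b \<longleftrightarrow>
     (\<exists>g. sensible \<phi> a b g \<and> (rt a, rt b) \<in> g \<and>
        (\<forall>w v w' v'. (w, v) \<in> g \<and> (w', v') \<in> g \<and> (v, v') \<in> access b \<longrightarrow> (w, w') \<in> access a))"

definition isomorphic :: "('w, 'p) lframe \<Rightarrow> ('v, 'p) lframe \<Rightarrow> bool" where
  "isomorphic a b \<longleftrightarrow>
     (\<exists>h. bij_betw h (worlds a) (worlds b) \<and> h (rt a) = rt b \<and>
        (\<forall>w \<in> worlds a. \<forall>v \<in> worlds a. (w, v) \<in> access a \<longleftrightarrow> (h w, h v) \<in> access b) \<and>
        (\<forall>w \<in> worlds a. tp b (h w) = tp a w))"

text \<open>
  Every finite frame has an isomorphic copy whose worlds are natural numbers, so the isomorphism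
  types of finite tree-like local frames are the isomorphism classes of such copies. The elements
  of \<open>I\<^sub>\<omega>(\<phi>)\<close> are these classes; the root type, the subframe relation and the arrow relation are
  invariant under isomorphism and are read off from representatives.
\<close>

definition fin_tree_frames :: "'p fm \<Rightarrow> (nat, 'p) lframe set" where
  "fin_tree_frames \<phi> = {a. local_frame \<phi> a \<and> finite (worlds a) \<and> tree_like a}"

type_synonym 'p iframe = "(nat, 'p) lframe set"

definition I_worlds :: "'p fm \<Rightarrow> 'p iframe set" where
  "I_worlds \<phi> =
     fin_tree_frames \<phi> //
       {(a, b). a \<in> fin_tree_frames \<phi> \<and> b \<in> fin_tree_frames \<phi> \<and> isomorphic a b}"

definition I_succeq :: "'p fm \<Rightarrow> ('p iframe \<times> 'p iframe) set" where
  "I_succeq \<phi> =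
     {(A, B). A \<in> I_worlds \<phi> \<and> B \<in> I_worlds \<phi> \<and> (\<exists>a \<in> A. \<exists>v \<in> worlds a. restrict_at a v \<in> B)}"

definition I_type :: "'p iframe \<Rightarrow> 'p fm set" where
  "I_type A = (THE s. \<forall>a \<in> A. tp a (rt a) = s)"

definition I_arrows :: "'p fm \<Rightarrow> ('p iframe \<times> 'p iframe) set" where
  "I_arrows \<phi> =
     {(A, B). A \<in> I_worlds \<phi> \<and> B \<in> I_worlds \<phi> \<and> (\<exists>a \<in> A. \<exists>b \<in> B. arrows \<phi> a b)}"

definition I_omega :: "'p fm \<Rightarrow> ('p iframe, 'p) qmodel" where
  "I_omega \<phi> =
     \<lparr>worlds = I_worlds \<phi>, access = I_succeq \<phi>, tp = I_type, transit = I_arrows \<phi>\<rparr>"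

definition point_type :: "'p fm \<Rightarrow> ('x, 'p) dtmodel \<Rightarrow> 'x \<Rightarrow> 'p fm set" where
  "point_type \<phi> M x = {\<psi> \<in> subpm \<phi>. x \<in> truth_set M \<psi>}"

definition simulation ::
  "'p fm \<Rightarrow> ('w, 'p, 'z) tframe_scheme \<Rightarrow> ('x, 'p) dtmodel \<Rightarrow> ('w \<times> 'x) set \<Rightarrow> bool" where
  "simulation \<phi> F M \<chi> \<longleftrightarrow>
     continuous_rel (up_topology F) (mtop M) \<chi> \<and>
     (\<forall>(w, x) \<in> \<chi>. point_type \<phi> M x = tp F w)"

definition maximal_simulation ::
  "'p fm \<Rightarrow> ('w, 'p, 'z) tframe_scheme \<Rightarrow> ('x, 'p) dtmodel \<Rightarrow> ('w \<times> 'x) set \<Rightarrow> bool" where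
  "maximal_simulation \<phi> F M \<chi> \<longleftrightarrow>
     simulation \<phi> F M \<chi> \<and> (\<forall>\<chi>'. simulation \<phi> F M \<chi>' \<and> \<chi> \<subseteq> \<chi>' \<longrightarrow> \<chi>' = \<chi>)"

lemma ex1_maximal_simulation: "\<exists>!\<chi>. maximal_simulation \<phi> F M \<chi>"
proof -
  define U where "U = \<Union>{\<chi>. simulation \<phi> F M \<chi>}"
  have pre: "U\<inverse> `` S = \<Union>((\<lambda>\<chi>. \<chi>\<inverse> `` S) ` {\<chi>. simulation \<phi> F M \<chi>})" for S
    unfolding U_def by auto
  have "openin (up_topology F) (U\<inverse> `` S)" if "openin (mtop M) S" for S
    unfolding pre using that
    by (intro openin_Union) (auto simp: simulation_def continuous_rel_def)
  moreover have "U \<subseteq> topspace (up_topology F) \<times> topspace (mtop M)"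
    unfolding U_def simulation_def continuous_rel_def by (intro Union_least) simp
  ultimately have "continuous_rel (up_topology F) (mtop M) U"
    by (simp add: continuous_rel_def)
  moreover have "\<forall>(w, x) \<in> U. point_type \<phi> M x = tp F w"
    unfolding U_def simulation_def by auto
  ultimately have sim: "simulation \<phi> F M U"
    by (simp add: simulation_def)
  have le: "\<chi> \<subseteq> U" if "simulation \<phi> F M \<chi>" for \<chi>
    using that unfolding U_def by (simp add: Union_upper)
  have "maximal_simulation \<phi> F M \<chi> \<longleftrightarrow> \<chi> = U" for \<chi>
    using sim le unfolding maximal_simulation_def by (metis subset_antisym)
  then show ?thesis by blast
qed

definition chi_star :: "'p fm \<Rightarrow> ('x, 'p) dtmodel \<Rightarrow> ('p iframe \<times> 'x) set" where
  "chi_star \<phi> M = (THE \<chi>. maximal_simulation \<phi> (I_omega \<phi>) M \<chi>)"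

definition restrict_qmodel :: "('w, 'p) qmodel \<Rightarrow> 'w set \<Rightarrow> ('w, 'p) qmodel" where
  "restrict_qmodel Q D =
     \<lparr>worlds = worlds Q \<inter> D, access = access Q \<inter> D \<times> D, tp = tp Q, transit = transit Q \<inter> D \<times> D\<rparr>"

definition model_quotient :: "('x, 'p) dtmodel \<Rightarrow> 'p fm \<Rightarrow> ('p iframe, 'p) qmodel" where
  "model_quotient M \<phi> =
     restrict_qmodel (I_omega \<phi>) {A \<in> worlds (I_omega \<phi>). chi_star \<phi> M `` {A} \<noteq> {}}"

end

theory Submission imports Defs begin

text \<open>
  Only two of the required properties use the topology of the model: every point of \<open>X\<close> is
  simulated by the root of some finite tree-like frame, and if \<open>\<aa>\<close> simulates \<open>x\<close> then
  some \<open>\<bb>\<close> reached from \<open>\<aa>\<close> by an arrow simulates \<open>f x\<close>. Each follows from the stronger claim that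
  finitely many frames suffice, by induction: on the number of formulas \<open>\<box>\<psi>\<close> that fail at the
  point in the first case, and along the clusters of \<open>\<aa>\<close> from the top in the second. Finiteness
  allows closures to be distributed over the union of the sets simulated by the frames found so
  far. In the induction step a set of points, coloured by their types, is covered: near a generic
  point the colours and the earlier frames seen in the limit are constant, so these points form a
  cluster with the earlier frames grafted above it, and every other point is a new root below one
  of finitely many such frames.
\<close>

section \<open>Subformulas and types\<close>

text \<open>Finiteness is the crux: a point in the closure of an infinite union need not be a limit
  of any one member, so frames chosen separately for every point could not be grafted above a common
  limit point. A cluster makes a second demand: the sets simulated by its worlds must lie in the
  closures of one another, which can be had at generic points only. Both inductions share one step,
  proved once for a continuous map \<open>f\<close>: the identity in the first use,
  \<open>mfun M\<close> in the second. In the second use a colour is a world of \<open>a\<close>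
  together with a type of \<open>f x\<close>, because points simulated by the same world may have
  images of different types. Since \<open>f\<close> is continuous but not open, points near
  \<open>f x\<close> that refute a box need not be images of points near \<open>x\<close>; the
  finite cover of the whole space obtained from the first induction supplies them. This is why the
  covering of points has to precede the arrows.\<close>

lemma subfms_self: "\<phi> \<in> subfms \<phi>"
  by (cases \<phi>) auto

lemma finite_subfms: "finite (subfms \<phi>)"
  by (induction \<phi>) auto

lemma finite_subpm: "finite (subpm \<phi>)"
  by (simp add: subpm_def finite_subfms)

lemma subfms_immediate:
  shows "And \<alpha> \<beta> \<in> subfms \<phi> \<Longrightarrow> \<alpha> \<in> subfms \<phi> \<and> \<beta> \<in> subfms \<phi>"
    and "Neg \<alpha> \<in> subfms \<phi> \<Longrightarrow> \<alpha> \<in> subfms \<phi>"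
    and "Box \<alpha> \<in> subfms \<phi> \<Longrightarrow> \<alpha> \<in> subfms \<phi>"
    and "Next \<alpha> \<in> subfms \<phi> \<Longrightarrow> \<alpha> \<in> subfms \<phi>"
    and "Star \<alpha> \<in> subfms \<phi> \<Longrightarrow> \<alpha> \<in> subfms \<phi>"
  by (induction \<phi>) (auto simp: subfms_self)

lemma subfms_subpm: "\<psi> \<in> subfms \<phi> \<Longrightarrow> \<psi> \<in> subpm \<phi>"
  by (simp add: subpm_def)

text \<open>\<open>neg\<close> adds a negation or strips one from a subformula, and what is left
  after stripping is again a subformula. In particular the boxes in \<open>subpm\<close> are genuine
  subformulas, and so are their arguments.\<close>

lemma subpm_subfms:
  assumes "\<psi> \<in> subpm \<phi>" and "\<And>\<chi>. \<psi> \<noteq> Neg \<chi>"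
  shows "\<psi> \<in> subfms \<phi>"
proof -
  have "\<psi> \<in> subfms \<phi>" if "\<psi> = neg \<chi>" and "\<chi> \<in> subfms \<phi>" for \<chi>
    using that assms(2) subfms_immediate(2) by (cases \<chi>) auto
  then show ?thesis
    using assms(1) by (auto simp: subpm_def)
qed

text \<open>\<open>neg\<close> is not an involution: \<open>Neg (Neg \<delta>)\<close> goes to
  \<open>Neg \<delta>\<close> and then to \<open>\<delta>\<close>. Closure holds because stripping a
  negation stays inside \<open>subfms\<close>, so that a second \<open>neg\<close> lands in the
  other half of \<open>subpm\<close>.\<close>

lemma neg_subpm:
  assumes "\<psi> \<in> subpm \<phi>"
  shows "neg \<psi> \<in> subpm \<phi>"
proof -
  have "neg (neg \<chi>) \<in> subpm \<phi>" if "\<chi> \<in> subfms \<phi>" for \<chi>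
  proof (cases \<chi>)
    case (Neg \<delta>)
    then show ?thesis
      using that subfms_immediate(2)[of \<delta> \<phi>] by (auto simp: subpm_def)
  qed (use that in \<open>auto simp: subpm_def\<close>)
  then show ?thesis
    using assms by (auto simp: subpm_def)
qed

lemma Box_subpm:
  assumes "Box \<psi> \<in> subpm \<phi>"
  shows "\<psi> \<in> subpm \<phi>"
  using assms subpm_subfms subfms_immediate(3) subfms_subpm by (metis fm.distinct(19))

lemma type_neg_iff:
  assumes "is_type \<phi> s" and "\<psi> \<in> subpm \<phi>"
  shows "neg \<psi> \<in> s \<longleftrightarrow> \<psi> \<notin> s"
  using assms unfolding is_type_def by blast

section \<open>Types realised by points of the model\<close>

lemma truth_set_subset:
  assumes "dyn_top_model M"
  shows "truth_set M \<psi> \<subseteq> topspace (mtop M)"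
  using assms by (induction \<psi>) (auto simp: dyn_top_model_def interior_of_subset_topspace)

lemma truth_set_neg:
  assumes "dyn_top_model M"
  shows "truth_set M (neg \<psi>) = topspace (mtop M) - truth_set M \<psi>"
  using truth_set_subset[OF assms] by (cases \<psi>) auto

lemma is_type_point_type:
  assumes "dyn_top_model M" and "x \<in> topspace (mtop M)"
  shows "is_type \<phi> (point_type \<phi> M x)"
proof -
  have and_sub: "\<psi>1 \<in> subpm \<phi> \<and> \<psi>2 \<in> subpm \<phi>" if "And \<psi>1 \<psi>2 \<in> subpm \<phi>" for \<psi>1 \<psi>2
    using subpm_subfms[OF that] subfms_immediate(1)[of \<psi>1 \<psi>2 \<phi>] by (auto simp: subpm_def)
  have "\<psi> \<notin> point_type \<phi> M x \<longleftrightarrow> neg \<psi> \<in> point_type \<phi> M x" if "\<psi> \<in> subpm \<phi>" for \<psi>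
    unfolding point_type_def using that neg_subpm[OF that] truth_set_neg[OF assms(1), of \<psi>] assms(2)
    by simp
  moreover have "point_type \<phi> M x \<subseteq> subpm \<phi>"
    by (auto simp: point_type_def)
  moreover have "And \<psi>1 \<psi>2 \<in> point_type \<phi> M x \<longleftrightarrow>
      \<psi>1 \<in> point_type \<phi> M x \<and> \<psi>2 \<in> point_type \<phi> M x"
    if "And \<psi>1 \<psi>2 \<in> subpm \<phi>" for \<psi>1 \<psi>2
    using and_sub[OF that] that by (simp add: point_type_def)
  ultimately show ?thesis
    unfolding is_type_def by blast
qed

text \<open>Sensible pairs imitate a point and its image; for \<open>Star\<close> this unrolls the
  orbit of \<open>x\<close> by one step.\<close>

lemma sensible_pair_point_type:
  assumes M: "dyn_top_model M" and x: "x \<in> topspace (mtop M)"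
  shows "sensible_pair \<phi> (point_type \<phi> M x) (point_type \<phi> M (mfun M x))"
proof -
  have fx: "mfun M x \<in> topspace (mtop M)"
    using M x by (auto simp: dyn_top_model_def continuous_map_def)
  have "x \<in> truth_set M (Star \<psi>) \<longleftrightarrow> x \<in> truth_set M \<psi> \<and> mfun M x \<in> truth_set M (Star \<psi>)" for \<psi>
  proof -
    have "(\<forall>n. (mfun M ^^ n) x \<in> truth_set M \<psi>) \<longleftrightarrow>
        x \<in> truth_set M \<psi> \<and> (\<forall>n. (mfun M ^^ n) (mfun M x) \<in> truth_set M \<psi>)"
      by (metis funpow_0 funpow_Suc_right comp_apply not0_implies_Suc)
    then show ?thesis
      using x fx by simp
  qed
  then have star: "x \<in> truth_set M (Star \<psi>) \<longleftrightarrow>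
      x \<in> truth_set M \<psi> \<and> mfun M x \<in> truth_set M (Star \<psi>)" for \<psi> .
  have "Next \<psi> \<in> point_type \<phi> M x \<longleftrightarrow> \<psi> \<in> point_type \<phi> M (mfun M x)"
    if "Next \<psi> \<in> subfms \<phi>" for \<psi>
    using subfms_subpm[OF that] subfms_subpm[OF subfms_immediate(4)[OF that]] x
    by (simp add: point_type_def)
  moreover have "Star \<psi> \<in> point_type \<phi> M x \<longleftrightarrow>
      \<psi> \<in> point_type \<phi> M x \<and> Star \<psi> \<in> point_type \<phi> M (mfun M x)"
    if "Star \<psi> \<in> subfms \<phi>" for \<psi>
    using subfms_subpm[OF that] subfms_subpm[OF subfms_immediate(5)[OF that]] star[of \<psi>]
    by (simp add: point_type_def del: truth_set.simps)
  ultimately show ?thesis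
    unfolding sensible_pair_def by blast
qed

text \<open>Each member needs a refuting world above, which is why the outer \<open>Box\<close> is
  dropped. The number of members is the rank in the induction that covers the points of the
  model.\<close>

definition defects :: "'p fm \<Rightarrow> 'p fm set \<Rightarrow> 'p fm set" where
  "defects \<phi> s = {\<psi>. Box \<psi> \<in> subpm \<phi> \<and> Box \<psi> \<notin> s}"

lemma finite_defects: "finite (defects \<phi> s)"
proof -
  have "Box ` defects \<phi> s \<subseteq> subpm \<phi>"
    by (auto simp: defects_def)
  then show ?thesis
    using finite_subpm[of \<phi>] finite_imageD[of Box "defects \<phi> s"] finite_subset
    by (metis fm.inject(4) inj_onI)
qed

lemma point_type_Pow: "point_type \<phi> M x \<in> Pow (subpm \<phi>)"
  by (auto simp: point_type_def)

text \<open>The interior of a truth set is a neighbourhood of \<open>x\<close>, hence meets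
  \<open>S\<close>, where the type is constant. This is how membership in a closure yields the box
  condition along an edge.\<close>

lemma Box_point_type_closure:
  assumes "Box \<psi> \<in> point_type \<phi> M x" and "x \<in> mtop M closure_of S"
    and "\<And>y. y \<in> S \<Longrightarrow> point_type \<phi> M y = s"
  shows "Box \<psi> \<in> s \<and> \<psi> \<in> s"
proof -
  have sub: "Box \<psi> \<in> subpm \<phi>" and x: "x \<in> mtop M interior_of truth_set M \<psi>"
    using assms(1) by (auto simp: point_type_def)
  obtain y where "y \<in> S" and y: "y \<in> mtop M interior_of truth_set M \<psi>"
    using assms(2) x openin_interior_of by (metis in_closure_of)
  then have "Box \<psi> \<in> point_type \<phi> M y" "\<psi> \<in> point_type \<phi> M y"
    using sub Box_subpm[OF sub] interior_of_subset[of "mtop M" "truth_set M \<psi>"]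
    by (auto simp: point_type_def)
  then show ?thesis
    using assms(3) \<open>y \<in> S\<close> by blast
qed

lemma closure_of_Union_finite:
  assumes "finite I" and "x \<in> T closure_of (\<Union>i\<in>I. S i)"
  obtains i where "i \<in> I" "x \<in> T closure_of S i"
  using assms closure_of_Union[of "S ` I" T] by auto

text \<open>Not being interior means being a limit of counterexamples. As there are finitely many
  types, counterexamples of one single type already accumulate at \<open>x\<close>.\<close>

lemma defect_point_type_closure:
  assumes M: "dyn_top_model M" and x: "x \<in> topspace (mtop M)"
    and "\<psi> \<in> defects \<phi> (point_type \<phi> M x)"
  obtains s where "s \<in> Pow (subpm \<phi>)" "\<psi> \<notin> s"
    "x \<in> mtop M closure_of {y \<in> topspace (mtop M). point_type \<phi> M y = s}"
proof -
  let ?X = "topspace (mtop M)"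
  let ?I = "{s \<in> Pow (subpm \<phi>). \<psi> \<notin> s}"
  have sub: "\<psi> \<in> subpm \<phi>" and nx: "x \<notin> mtop M interior_of truth_set M \<psi>"
    using assms(3) Box_subpm by (auto simp: defects_def point_type_def)
  have "x \<in> mtop M closure_of (?X - truth_set M \<psi>)"
    using nx x by (simp add: closure_of_complement)
  moreover have "?X - truth_set M \<psi> \<subseteq> (\<Union>s\<in>?I. {y \<in> ?X. point_type \<phi> M y = s})"
  proof
    fix y
    assume "y \<in> ?X - truth_set M \<psi>"
    then have "y \<in> ?X" "point_type \<phi> M y \<in> ?I"
      by (simp_all add: point_type_def)
    then show "y \<in> (\<Union>s\<in>?I. {y \<in> ?X. point_type \<phi> M y = s})"
      by blast
  qed
  ultimately have "x \<in> mtop M closure_of (\<Union>s\<in>?I. {y \<in> ?X. point_type \<phi> M y = s})"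
    using closure_of_mono by blast
  then show ?thesis
    by (rule closure_of_Union_finite[rotated]) (use that finite_subpm[of \<phi>] in \<open>auto simp: finite_Collect_conjI\<close>)
qed

section \<open>Finite frames and their isomorphism classes\<close>

lemma typed_frameD:
  assumes "typed_frame \<phi> F"
  shows "(w, v) \<in> access F \<Longrightarrow> w \<in> worlds F" "(w, v) \<in> access F \<Longrightarrow> v \<in> worlds F"
    "w \<in> worlds F \<Longrightarrow> (w, w) \<in> access F"
    "(u, v) \<in> access F \<Longrightarrow> (v, w) \<in> access F \<Longrightarrow> (u, w) \<in> access F"
    "w \<in> worlds F \<Longrightarrow> is_type \<phi> (tp F w)"
    "w \<in> worlds F \<Longrightarrow> Box \<psi> \<in> subpm \<phi> \<Longrightarrow>
       Box \<psi> \<in> tp F w \<longleftrightarrow> (\<forall>v. (w, v) \<in> access F \<longrightarrow> \<psi> \<in> tp F v)"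
  using assms unfolding typed_frame_def
  by (blast, blast, blast dest: refl_onD, blast dest: transD, blast, blast)

text \<open>Openness in the up-set topology is a condition on single edges, so continuity can be
  read off edge by edge: every neighbourhood of an image of \<open>w\<close> meets the image of each
  successor \<open>v\<close>.\<close>

lemma continuous_rel_up_iff:
  "continuous_rel (up_topology F) T g \<longleftrightarrow>
     g \<subseteq> worlds F \<times> topspace T \<and>
     (\<forall>w x v. (w, x) \<in> g \<and> v \<in> worlds F \<and> (w, v) \<in> access F \<longrightarrow> x \<in> T closure_of (g `` {v}))"
  unfolding continuous_rel_def topspace_up_topology openin_up_topology in_closure_of
  by (rule conj_cong[OF refl]) (safe, blast+)

text \<open>In an up-set topology the closure of a set is its down-set, so continuity becomes the
  forth condition known from bisimulations.\<close>

lemma continuous_rel_up_up_iff: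
  assumes "typed_frame \<phi> G"
  shows "continuous_rel (up_topology F) (up_topology G) g \<longleftrightarrow>
     g \<subseteq> worlds F \<times> worlds G \<and>
     (\<forall>w x v. (w, x) \<in> g \<and> v \<in> worlds F \<and> (w, v) \<in> access F \<longrightarrow>
        (\<exists>y. (x, y) \<in> access G \<and> (v, y) \<in> g))"
proof -
  have cl: "x \<in> up_topology G closure_of S \<longleftrightarrow> (\<exists>y\<in>S. (x, y) \<in> access G)"
    if "x \<in> worlds G" "S \<subseteq> worlds G" for x S
  proof
    assume "x \<in> up_topology G closure_of S"
    \<comment> \<open>The up-set of \<open>x\<close> is its least neighbourhood; testing against
      this one is enough.\<close>
    moreover have "openin (up_topology G) {y. (x, y) \<in> access G}"
      unfolding openin_up_topology using typed_frameD(2,4)[OF assms] by blast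
    ultimately show "\<exists>y\<in>S. (x, y) \<in> access G"
      unfolding in_closure_of using typed_frameD(3)[OF assms that(1)] by auto
  next
    assume "\<exists>y\<in>S. (x, y) \<in> access G"
    then show "x \<in> up_topology G closure_of S"
      unfolding in_closure_of openin_up_topology topspace_up_topology using that by blast
  qed
  have "x \<in> up_topology G closure_of (g `` {v}) \<longleftrightarrow> (\<exists>y. (x, y) \<in> access G \<and> (v, y) \<in> g)"
    if "g \<subseteq> worlds F \<times> worlds G" "(w, x) \<in> g" for w x v
    using cl[of x "g `` {v}"] that by auto
  then show ?thesis
    unfolding continuous_rel_up_iff topspace_up_topology by (intro conj_cong[OF refl]) metis
qed

text \<open>Transitivity makes the order of clusters independent of representatives, so it may be
  tested on worlds.\<close>

lemma tree_like_iff: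
  assumes F: "typed_frame \<phi> F"
  shows "tree_like F \<longleftrightarrow>
     (\<forall>u v w. (u, w) \<in> access F \<and> (v, w) \<in> access F \<longrightarrow> (u, v) \<in> access F \<or> (v, u) \<in> access F)"
proof -
  let ?c = "\<lambda>w. {v. (w, v) \<in> access F \<and> (v, w) \<in> access F}"
  have cl: "clusters F = ?c ` worlds F"
    unfolding clusters_def quotient_def by auto
  have le: "cluster_le F (?c w) (?c v) \<longleftrightarrow> (w, v) \<in> access F" if "w \<in> worlds F" "v \<in> worlds F" for w v
    unfolding cluster_le_def using typed_frameD(3,4)[OF F] that by blast
  show ?thesis
    unfolding tree_like_def cl ball_simps using typed_frameD(1,2)[OF F]
    by (simp add: le cong: ball_cong) blast
qed

lemma restrict_at_simps [simp]:
  "worlds (restrict_at a v) = {w \<in> worlds a. (v, w) \<in> access a}"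
  "access (restrict_at a v) =
     access a \<inter> {w \<in> worlds a. (v, w) \<in> access a} \<times> {w \<in> worlds a. (v, w) \<in> access a}"
  "tp (restrict_at a v) = tp a"
  "rt (restrict_at a v) = v"
  by (simp_all add: restrict_at_def Let_def)

lemma fin_tree_framesD:
  assumes "a \<in> fin_tree_frames \<phi>"
  shows "typed_frame \<phi> a" "rt a \<in> worlds a" "v \<in> worlds a \<Longrightarrow> (rt a, v) \<in> access a"
    "finite (worlds a)"
    "(u, w) \<in> access a \<Longrightarrow> (v, w) \<in> access a \<Longrightarrow> (u, v) \<in> access a \<or> (v, u) \<in> access a"
  using assms tree_like_iff[of \<phi> a] unfolding fin_tree_frames_def local_frame_def by auto

lemma fin_tree_framesI:
  assumes "typed_frame \<phi> a" "rt a \<in> worlds a" "\<And>v. v \<in> worlds a \<Longrightarrow> (rt a, v) \<in> access a"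
    "finite (worlds a)"
    "\<And>u v w. (u, w) \<in> access a \<Longrightarrow> (v, w) \<in> access a \<Longrightarrow> (u, v) \<in> access a \<or> (v, u) \<in> access a"
  shows "a \<in> fin_tree_frames \<phi>"
  using assms tree_like_iff[of \<phi> a] unfolding fin_tree_frames_def local_frame_def by auto

lemma restrict_at_fin_tree_frames:
  assumes a: "a \<in> fin_tree_frames \<phi>" and v: "v \<in> worlds a"
  shows "restrict_at a v \<in> fin_tree_frames \<phi>"
proof (rule fin_tree_framesI)
  note F = typed_frameD[OF fin_tree_framesD(1)[OF a]]
  have "Box \<psi> \<in> tp a w \<longleftrightarrow> (\<forall>u. (w, u) \<in> access (restrict_at a v) \<longrightarrow> \<psi> \<in> tp a u)"
    if "(v, w) \<in> access a" "Box \<psi> \<in> subpm \<phi>" for w \<psi>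
  proof -
    have "(w, u) \<in> access (restrict_at a v) \<longleftrightarrow> (w, u) \<in> access a" for u
      using F(1,2)[of w] F(4)[OF that(1)] that(1) by auto
    then show ?thesis
      using F(6)[OF F(2)[OF that(1)] that(2)] by simp
  qed
  moreover have "trans (access (restrict_at a v))"
    by (rule transI) (auto dest: F(4))
  moreover have "refl_on (worlds (restrict_at a v)) (access (restrict_at a v))"
    by (rule refl_onI) (auto intro: F(3))
  ultimately show "typed_frame \<phi> (restrict_at a v)"
    unfolding typed_frame_def using F(5) by simp
next
  fix u w u'
  assume "(u, w) \<in> access (restrict_at a v)" and "(u', w) \<in> access (restrict_at a v)"
  then show "(u, u') \<in> access (restrict_at a v) \<or> (u', u) \<in> access (restrict_at a v)"
    using fin_tree_framesD(5)[OF a, of u w u'] by auto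
qed (use fin_tree_framesD(4)[OF a] typed_frameD(3)[OF fin_tree_framesD(1)[OF a] v] v in auto)

text \<open>A literal equality of records, not just an isomorphism: \<open>restrict_at\<close> keeps
  \<open>tp\<close> as it is, even outside the up-set.\<close>

lemma restrict_at_restrict_at:
  assumes "typed_frame \<phi> a" and "(v, w) \<in> access a"
  shows "restrict_at (restrict_at a v) w = restrict_at a w"
proof -
  note F = typed_frameD(1,2,4)[OF assms(1)]
  have sub: "(v, u) \<in> access a" if "(w, u) \<in> access a" for u
    using F(3)[OF assms(2) that] .
  then have "{u \<in> worlds (restrict_at a v). (w, u) \<in> access (restrict_at a v)} =
      {u \<in> worlds a. (w, u) \<in> access a}"
    using F(2)[OF assms(2)] assms(2) by auto
  moreover have "access (restrict_at a v) \<inter> {u \<in> worlds a. (w, u) \<in> access a} \<times> {u \<in> worlds a. (w, u) \<in> access a}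
      = access a \<inter> {u \<in> worlds a. (w, u) \<in> access a} \<times> {u \<in> worlds a. (w, u) \<in> access a}"
    using sub by auto
  ultimately show ?thesis
    unfolding restrict_at_def[of "restrict_at a v" w] restrict_at_def[of a w] by simp
qed

lemma restrict_at_rt:
  assumes "a \<in> fin_tree_frames \<phi>"
  shows "restrict_at a (rt a) = a"
proof -
  have "{w \<in> worlds a. (rt a, w) \<in> access a} = worlds a"
    using fin_tree_framesD[OF assms] by blast
  moreover have "access a \<inter> worlds a \<times> worlds a = access a"
    using typed_frameD[OF fin_tree_framesD(1)[OF assms]] by auto
  ultimately show ?thesis
    by (simp add: restrict_at_def)
qed

section \<open>Isomorphism classes as the worlds of \<open>I_omega\<close>\<close>

lemma isomorphic_refl: "isomorphic a a"
  unfolding isomorphic_def by (rule exI[of _ id]) auto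

lemma isomorphic_sym:
  assumes "rt a \<in> worlds a" and "isomorphic a b"
  shows "isomorphic b a"
proof -
  obtain h where h: "bij_betw h (worlds a) (worlds b)" "h (rt a) = rt b"
    "\<And>w v. w \<in> worlds a \<Longrightarrow> v \<in> worlds a \<Longrightarrow> (w, v) \<in> access a \<longleftrightarrow> (h w, h v) \<in> access b"
    "\<And>w. w \<in> worlds a \<Longrightarrow> tp b (h w) = tp a w"
    using assms(2) unfolding isomorphic_def by blast
  let ?k = "inv_into (worlds a) h"
  have k: "?k w \<in> worlds a" "h (?k w) = w" if "w \<in> worlds b" for w
    using that h(1) by (auto simp: bij_betw_def inv_into_into f_inv_into_f)
  have "?k (rt b) = rt a"
    using h(1,2) assms(1) by (metis bij_betw_inv_into_left)
  then show ?thesis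
    unfolding isomorphic_def using bij_betw_inv_into[OF h(1)] k h(3,4)
    by (intro exI[of _ ?k]) (metis (no_types, lifting))
qed

lemma isomorphic_trans:
  assumes "isomorphic a b" and "isomorphic b c"
  shows "isomorphic a c"
proof -
  obtain h where h: "bij_betw h (worlds a) (worlds b)" "h (rt a) = rt b"
    "\<And>w v. w \<in> worlds a \<Longrightarrow> v \<in> worlds a \<Longrightarrow> (w, v) \<in> access a \<longleftrightarrow> (h w, h v) \<in> access b"
    "\<And>w. w \<in> worlds a \<Longrightarrow> tp b (h w) = tp a w"
    using assms(1) unfolding isomorphic_def by blast
  obtain k where k: "bij_betw k (worlds b) (worlds c)" "k (rt b) = rt c"
    "\<And>w v. w \<in> worlds b \<Longrightarrow> v \<in> worlds b \<Longrightarrow> (w, v) \<in> access b \<longleftrightarrow> (k w, k v) \<in> access c"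
    "\<And>w. w \<in> worlds b \<Longrightarrow> tp c (k w) = tp b w"
    using assms(2) unfolding isomorphic_def by blast
  have "h w \<in> worlds b" if "w \<in> worlds a" for w
    using that h(1) by (auto simp: bij_betw_def)
  then show ?thesis
    unfolding isomorphic_def using bij_betw_trans[OF h(1) k(1)] h k
    by (intro exI[of _ "k \<circ> h"]) auto
qed

definition iso_class :: "'p fm \<Rightarrow> (nat, 'p) lframe \<Rightarrow> 'p iframe" where
  "iso_class \<phi> a = {b \<in> fin_tree_frames \<phi>. isomorphic a b}"

lemma I_worlds_eq: "I_worlds \<phi> = iso_class \<phi> ` fin_tree_frames \<phi>"
  unfolding I_worlds_def quotient_def iso_class_def by auto

lemma iso_class_eq:
  assumes "a \<in> fin_tree_frames \<phi>" and "isomorphic a b"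
  shows "iso_class \<phi> a = iso_class \<phi> b"
  using assms isomorphic_trans isomorphic_sym[OF fin_tree_framesD(2)[OF assms(1)]]
  unfolding iso_class_def by blast

lemma iso_class_self: "a \<in> fin_tree_frames \<phi> \<Longrightarrow> a \<in> iso_class \<phi> a"
  by (simp add: iso_class_def isomorphic_refl)

lemma I_worlds_rep:
  assumes "A \<in> I_worlds \<phi>" and "a \<in> A"
  shows "a \<in> fin_tree_frames \<phi>" "A = iso_class \<phi> a"
  using assms iso_class_eq unfolding I_worlds_eq by (auto simp: iso_class_def)

lemma I_type_iso_class:
  assumes "a \<in> fin_tree_frames \<phi>"
  shows "I_type (iso_class \<phi> a) = tp a (rt a)"
proof -
  have "tp b (rt b) = tp a (rt a)" if b: "b \<in> iso_class \<phi> a" for b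
  proof -
    obtain h where h: "h (rt a) = rt b" "\<forall>w\<in>worlds a. tp b (h w) = tp a w"
      using b unfolding iso_class_def isomorphic_def by auto
    show ?thesis
      using bspec[OF h(2) fin_tree_framesD(2)[OF assms]] h(1) by simp
  qed
  then have "\<forall>b\<in>iso_class \<phi> a. tp b (rt b) = tp a (rt a)"
    by blast
  then show ?thesis
    unfolding I_type_def by (rule the_equality) (metis iso_class_self[OF assms])
qed

text \<open>Stated for a map \<open>h\<close> instead of \<open>isomorphic a b\<close>, so that the
  world \<open>h v\<close> corresponding to \<open>v\<close> can be named.\<close>

lemma isomorphic_restrict_at:
  assumes h: "bij_betw h (worlds a) (worlds b)"
    "\<And>w v. w \<in> worlds a \<Longrightarrow> v \<in> worlds a \<Longrightarrow> (w, v) \<in> access a \<longleftrightarrow> (h w, h v) \<in> access b"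
    "\<And>w. w \<in> worlds a \<Longrightarrow> tp b (h w) = tp a w" and v: "v \<in> worlds a"
  shows "isomorphic (restrict_at a v) (restrict_at b (h v))"
proof -
  have "h ` {w \<in> worlds a. (v, w) \<in> access a} = {w \<in> worlds b. (h v, w) \<in> access b}"
    unfolding bij_betw_imp_surj_on[OF h(1), symmetric] using h(2)[OF v] by auto
  then have "bij_betw h {w \<in> worlds a. (v, w) \<in> access a} {w \<in> worlds b. (h v, w) \<in> access b}"
    using h(1) by (auto simp: bij_betw_def intro: inj_on_subset)
  moreover have "h w \<in> worlds b" if "w \<in> worlds a" for w
    using that h(1) by (auto simp: bij_betw_def)
  ultimately show ?thesis
    unfolding isomorphic_def using h v by (intro exI[of _ h]) auto
qed

text \<open>\<open>I_succeq\<close> is free to choose the representative of the larger class. An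
  isomorphism carries the chosen world over to the given representative \<open>a\<close>.\<close>

lemma I_succeq_iff:
  assumes a: "a \<in> fin_tree_frames \<phi>"
  shows "(iso_class \<phi> a, B) \<in> I_succeq \<phi> \<longleftrightarrow> (\<exists>v\<in>worlds a. B = iso_class \<phi> (restrict_at a v))"
proof
  assume "(iso_class \<phi> a, B) \<in> I_succeq \<phi>"
  then obtain b v where B: "B \<in> I_worlds \<phi>" and b: "b \<in> fin_tree_frames \<phi>" "isomorphic a b"
    and v: "v \<in> worlds b" "restrict_at b v \<in> B"
    unfolding I_succeq_def iso_class_def by auto
  have "isomorphic b a"
    using isomorphic_sym[OF fin_tree_framesD(2)[OF a] b(2)] .
  then obtain h where h: "bij_betw h (worlds b) (worlds a)"
    "\<And>w v. w \<in> worlds b \<Longrightarrow> v \<in> worlds b \<Longrightarrow> (w, v) \<in> access b \<longleftrightarrow> (h w, h v) \<in> access a"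
    "\<And>w. w \<in> worlds b \<Longrightarrow> tp a (h w) = tp b w"
    unfolding isomorphic_def by blast
  have "B = iso_class \<phi> (restrict_at b v)"
    using I_worlds_rep[OF B v(2)] by simp
  also have "\<dots> = iso_class \<phi> (restrict_at a (h v))"
    using isomorphic_restrict_at[OF h v(1)] restrict_at_fin_tree_frames[OF b(1) v(1)]
    by (rule_tac iso_class_eq)
  finally show "\<exists>v\<in>worlds a. B = iso_class \<phi> (restrict_at a v)"
    using h(1) v(1) by (auto simp: bij_betw_def)
next
  assume "\<exists>v\<in>worlds a. B = iso_class \<phi> (restrict_at a v)"
  then show "(iso_class \<phi> a, B) \<in> I_succeq \<phi>"
    unfolding I_succeq_def I_worlds_eq
    using a iso_class_self restrict_at_fin_tree_frames[OF a] by blast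
qed

text \<open>The class of the subframe at \<open>v\<close> has type \<open>tp a v\<close>, so the box
  clause for a class is the box clause at the root of a representative, which sees all
  worlds.\<close>

lemma typed_frame_I_omega: "typed_frame \<phi> (I_omega \<phi>)"
proof -
  have refl: "(A, A) \<in> I_succeq \<phi>" if "A \<in> I_worlds \<phi>" for A
  proof -
    from that obtain a where a: "a \<in> fin_tree_frames \<phi>" and A: "A = iso_class \<phi> a"
      unfolding I_worlds_eq by auto
    show ?thesis
      unfolding A I_succeq_iff[OF a] using fin_tree_framesD(2)[OF a] restrict_at_rt[OF a]
      by (intro bexI[of _ "rt a"]) simp_all
  qed
  have trans: "(A, C) \<in> I_succeq \<phi>" if AB: "(A, B) \<in> I_succeq \<phi>" and BC: "(B, C) \<in> I_succeq \<phi>" for A B C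
  proof -
    obtain a where a: "a \<in> fin_tree_frames \<phi>" and A: "A = iso_class \<phi> a"
      using AB unfolding I_succeq_def I_worlds_eq by auto
    then obtain v where v: "v \<in> worlds a" and B: "B = iso_class \<phi> (restrict_at a v)"
      using AB I_succeq_iff by blast
    then obtain w where w: "w \<in> worlds (restrict_at a v)"
      and C: "C = iso_class \<phi> (restrict_at (restrict_at a v) w)"
      using BC I_succeq_iff restrict_at_fin_tree_frames[OF a v] by blast
    then show ?thesis
      using restrict_at_restrict_at[OF fin_tree_framesD(1)[OF a], of v w] a A I_succeq_iff by auto
  qed
  have "is_type \<phi> (I_type A)" if "A \<in> I_worlds \<phi>" for A
    using that typed_frameD(5)[OF fin_tree_framesD(1,2)]
    unfolding I_worlds_eq by (auto simp: I_type_iso_class)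
  moreover have "Box \<psi> \<in> I_type A \<longleftrightarrow> (\<forall>B. (A, B) \<in> I_succeq \<phi> \<longrightarrow> \<psi> \<in> I_type B)"
    if "A \<in> I_worlds \<phi>" and sub: "Box \<psi> \<in> subpm \<phi>" for A \<psi>
  proof -
    from that obtain a where a: "a \<in> fin_tree_frames \<phi>" and A: "A = iso_class \<phi> a"
      unfolding I_worlds_eq by auto
    have "I_type (iso_class \<phi> (restrict_at a v)) = tp a v" if "v \<in> worlds a" for v
      using I_type_iso_class[OF restrict_at_fin_tree_frames[OF a that]] by simp
    then show ?thesis
      unfolding A I_type_iso_class[OF a] I_succeq_iff[OF a]
      typed_frameD(6)[OF fin_tree_framesD(1)[OF a] fin_tree_framesD(2)[OF a] sub]
      using typed_frameD(2)[OF fin_tree_framesD(1)[OF a]] fin_tree_framesD(3)[OF a] by blast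
  qed
  moreover have "I_succeq \<phi> \<subseteq> I_worlds \<phi> \<times> I_worlds \<phi>"
    by (auto simp: I_succeq_def)
  moreover have "refl_on (I_worlds \<phi>) (I_succeq \<phi>)"
    using refl by (rule refl_onI)
  moreover have "Relation.trans (I_succeq \<phi>)"
    using trans by (rule transI)
  ultimately show ?thesis
    unfolding typed_frame_def I_omega_def by simp
qed

section \<open>Simulated points\<close>

lemma simulation_iff:
  "simulation \<phi> F M \<chi> \<longleftrightarrow>
     \<chi> \<subseteq> worlds F \<times> topspace (mtop M) \<and>
     (\<forall>w x v. (w, x) \<in> \<chi> \<and> v \<in> worlds F \<and> (w, v) \<in> access F \<longrightarrow>
        x \<in> mtop M closure_of (\<chi> `` {v})) \<and>
     (\<forall>w x. (w, x) \<in> \<chi> \<longrightarrow> point_type \<phi> M x = tp F w)"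
  unfolding simulation_def continuous_rel_up_iff by auto

definition max_sim :: "'p fm \<Rightarrow> ('w, 'p, 'z) tframe_scheme \<Rightarrow> ('x, 'p) dtmodel \<Rightarrow> ('w \<times> 'x) set" where
  "max_sim \<phi> F M = \<Union>{\<chi>. simulation \<phi> F M \<chi>}"

lemma max_sim_greatest: "simulation \<phi> F M \<chi> \<Longrightarrow> \<chi> \<subseteq> max_sim \<phi> F M"
  by (auto simp: max_sim_def)

lemma simulation_max_sim: "simulation \<phi> F M (max_sim \<phi> F M)"
proof -
  obtain \<chi> where \<chi>: "maximal_simulation \<phi> F M \<chi>"
    using ex1_maximal_simulation[of \<phi> F M] by blast
  have "\<chi>' \<subseteq> \<chi>" if "simulation \<phi> F M \<chi>'" for \<chi>'
  proof -
    have S: "simulation \<phi> F M \<chi>"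
      using \<chi> by (simp add: maximal_simulation_def)
    have "(\<chi> \<union> \<chi>')\<inverse> `` U = \<chi>\<inverse> `` U \<union> \<chi>'\<inverse> `` U" for U
      by auto
    then have "simulation \<phi> F M (\<chi> \<union> \<chi>')"
      using S that unfolding simulation_def continuous_rel_def by auto
    then show ?thesis
      using \<chi> unfolding maximal_simulation_def by blast
  qed
  moreover have "simulation \<phi> F M \<chi>"
    using \<chi> by (simp add: maximal_simulation_def)
  ultimately have "max_sim \<phi> F M = \<chi>"
    unfolding max_sim_def by blast
  then show ?thesis
    using \<open>simulation \<phi> F M \<chi>\<close> by simp
qed

lemma chi_star_eq: "chi_star \<phi> M = max_sim \<phi> (I_omega \<phi>) M"
proof -
  have "maximal_simulation \<phi> (I_omega \<phi>) M (max_sim \<phi> (I_omega \<phi>) M)"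
    unfolding maximal_simulation_def using simulation_max_sim max_sim_greatest by blast
  then show ?thesis
    unfolding chi_star_def using ex1_maximal_simulation by (rule_tac the1_equality)
qed

lemma max_simD:
  assumes "(w, x) \<in> max_sim \<phi> F M"
  shows "w \<in> worlds F" "x \<in> topspace (mtop M)" "point_type \<phi> M x = tp F w"
    "v \<in> worlds F \<Longrightarrow> (w, v) \<in> access F \<Longrightarrow> x \<in> mtop M closure_of (max_sim \<phi> F M `` {v})"
  using simulation_max_sim[of \<phi> F M] assms unfolding simulation_iff by blast+

text \<open>By \<open>chi_star_iff\<close> this is the value of \<open>chi_star\<close> at the class
  of \<open>a\<close>, computed inside the finite frame alone.\<close>

definition simulated :: "'p fm \<Rightarrow> ('x, 'p) dtmodel \<Rightarrow> ('w, 'p) lframe \<Rightarrow> 'x set" where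
  "simulated \<phi> M a = max_sim \<phi> a M `` {rt a}"

lemma point_type_simulated: "x \<in> simulated \<phi> M a \<Longrightarrow> point_type \<phi> M x = tp a (rt a)"
  using max_simD(2,3) by (fastforce simp: simulated_def)

text \<open>Sending \<open>w\<close> to the class of the subframe at \<open>w\<close> is a bounded
  morphism into \<open>I_omega \<phi>\<close>. Monotonicity lets simulations be pulled back along
  it; the back condition, that every subframe of the one at \<open>w\<close> sits at some
  \<open>v\<close> above \<open>w\<close>, lets them be pushed forward.\<close>

lemma chi_star_iff:
  assumes a: "a \<in> fin_tree_frames \<phi>"
  shows "(iso_class \<phi> a, x) \<in> chi_star \<phi> M \<longleftrightarrow> x \<in> simulated \<phi> M a"
proof
  let ?Z = "max_sim \<phi> (I_omega \<phi>) M"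
  let ?c = "\<lambda>w. iso_class \<phi> (restrict_at a w)"
  assume x: "(iso_class \<phi> a, x) \<in> chi_star \<phi> M"
  define \<sigma> where "\<sigma> = {(w, y). w \<in> worlds a \<and> (?c w, y) \<in> ?Z}"
  have "simulation \<phi> a M \<sigma>"
    unfolding simulation_iff
  proof (intro conjI allI impI)
    show "\<sigma> \<subseteq> worlds a \<times> topspace (mtop M)"
      using max_simD(2) by (fastforce simp: \<sigma>_def)
  next
    fix w y v
    assume *: "(w, y) \<in> \<sigma> \<and> v \<in> worlds a \<and> (w, v) \<in> access a"
    then have w: "w \<in> worlds a" and Z: "(?c w, y) \<in> ?Z"
      by (auto simp: \<sigma>_def)
    have "(?c w, ?c v) \<in> I_succeq \<phi>"
      using restrict_at_restrict_at[OF fin_tree_framesD(1)[OF a], of w v] *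
      unfolding I_succeq_iff[OF restrict_at_fin_tree_frames[OF a w]] by (intro bexI[of _ v]) auto
    moreover have "?c v \<in> I_worlds \<phi>"
      unfolding I_worlds_eq using restrict_at_fin_tree_frames[OF a] * by blast
    ultimately have "y \<in> mtop M closure_of (?Z `` {?c v})"
      using max_simD(4)[OF Z, of "?c v"] by (simp add: I_omega_def)
    moreover have "?Z `` {?c v} = \<sigma> `` {v}"
      using * by (auto simp: \<sigma>_def)
    ultimately show "y \<in> mtop M closure_of (\<sigma> `` {v})"
      by simp
  next
    fix w y
    assume "(w, y) \<in> \<sigma>"
    then have w: "w \<in> worlds a" and Z: "(?c w, y) \<in> ?Z"
      by (auto simp: \<sigma>_def)
    have "point_type \<phi> M y = I_type (?c w)"
      using max_simD(3)[OF Z] by (simp add: I_omega_def)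
    then show "point_type \<phi> M y = tp a w"
      by (simp add: I_type_iso_class restrict_at_fin_tree_frames[OF a w])
  qed
  moreover have "(rt a, x) \<in> \<sigma>"
    using x fin_tree_framesD(2)[OF a] by (simp add: \<sigma>_def restrict_at_rt[OF a] chi_star_eq)
  ultimately show "x \<in> simulated \<phi> M a"
    using max_sim_greatest[of \<phi> a M \<sigma>] by (auto simp: simulated_def)
next
  let ?Z = "max_sim \<phi> a M"
  let ?c = "\<lambda>w. iso_class \<phi> (restrict_at a w)"
  assume x: "x \<in> simulated \<phi> M a"
  define \<sigma> where "\<sigma> = {(?c w, y) | w y. (w, y) \<in> ?Z}"
  have Z: "w \<in> worlds a" "y \<in> topspace (mtop M)" "point_type \<phi> M y = tp a w" if "(w, y) \<in> ?Z" for w y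
    using max_simD(1-3)[OF that] by auto
  have "simulation \<phi> (I_omega \<phi>) M \<sigma>"
    unfolding simulation_iff
  proof (intro conjI allI impI)
    show "\<sigma> \<subseteq> worlds (I_omega \<phi>) \<times> topspace (mtop M)"
      using Z restrict_at_fin_tree_frames[OF a] by (auto simp: \<sigma>_def I_omega_def I_worlds_eq)
  next
    fix A y B
    assume *: "(A, y) \<in> \<sigma> \<and> B \<in> worlds (I_omega \<phi>) \<and> (A, B) \<in> access (I_omega \<phi>)"
    then obtain w where A: "A = ?c w" and wy: "(w, y) \<in> ?Z"
      by (auto simp: \<sigma>_def)
    have "(?c w, B) \<in> I_succeq \<phi>"
      using * A by (simp add: I_omega_def)
    then obtain v where v: "v \<in> worlds (restrict_at a w)"
      and B: "B = iso_class \<phi> (restrict_at (restrict_at a w) v)"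
      using I_succeq_iff restrict_at_fin_tree_frames[OF a Z(1)[OF wy]] by blast
    have B: "B = ?c v"
      using B v restrict_at_restrict_at[OF fin_tree_framesD(1)[OF a], of w v] by simp
    have "y \<in> mtop M closure_of (?Z `` {v})"
      using max_simD(4)[OF wy, of v] v by auto
    \<comment> \<open>Only an inclusion, because different worlds may carry isomorphic subframes;
      monotonicity of closure is enough.\<close>
    moreover have "?Z `` {v} \<subseteq> \<sigma> `` {B}"
      unfolding B by (auto simp: \<sigma>_def)
    ultimately show "y \<in> mtop M closure_of (\<sigma> `` {B})"
      using closure_of_mono by blast
  next
    fix A y
    assume "(A, y) \<in> \<sigma>"
    then obtain w where "A = ?c w" and wy: "(w, y) \<in> ?Z"
      by (auto simp: \<sigma>_def)
    then show "point_type \<phi> M y = tp (I_omega \<phi>) A"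
      using Z(3)[OF wy]
      by (simp add: I_type_iso_class restrict_at_fin_tree_frames[OF a Z(1)[OF wy]] I_omega_def)
  qed
  moreover have "(iso_class \<phi> a, x) \<in> \<sigma>"
    using x unfolding \<sigma>_def simulated_def by (force simp: restrict_at_rt[OF a])
  ultimately show "(iso_class \<phi> a, x) \<in> chi_star \<phi> M"
    unfolding chi_star_eq using max_sim_greatest by blast
qed

section \<open>Grafting frames onto a cluster\<close>

text \<open>Worlds have to be natural numbers, so a tag and a world are packed by
  \<open>prod_encode\<close>: tag \<open>0\<close> is the bottom cluster with types
  \<open>ts\<close>, tag \<open>Suc j\<close> a copy of \<open>bs ! j\<close>. The tags keep the
  copies disjoint even if a frame is listed twice. \<open>r\<close> selects the root within the
  cluster.\<close>

definition graft :: "nat \<Rightarrow> 'p fm set list \<Rightarrow> (nat, 'p) lframe list \<Rightarrow> (nat, 'p) lframe" where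
  "graft r ts bs =
     (let U = {prod_encode (0, i) | i. i < length ts} \<union>
              {prod_encode (Suc j, v) | j v. j < length bs \<and> v \<in> worlds (bs ! j)}
      in \<lparr>worlds = U,
          access = {(prod_encode (0, i), u) | i u. i < length ts \<and> u \<in> U} \<union>
            {(prod_encode (Suc j, v), prod_encode (Suc j, v')) | j v v'.
               j < length bs \<and> (v, v') \<in> access (bs ! j)},
          tp = (\<lambda>u. case prod_decode u of
                  (0, i) \<Rightarrow> ts ! i
                | (Suc j, v) \<Rightarrow> tp (bs ! j) v),
          rt = prod_encode (0, r)\<rparr>)"

lemma worlds_graft [simp]:
  "prod_encode (0, i) \<in> worlds (graft r ts bs) \<longleftrightarrow> i < length ts"
  "prod_encode (Suc j, v) \<in> worlds (graft r ts bs) \<longleftrightarrow> j < length bs \<and> v \<in> worlds (bs ! j)"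
  by (auto simp: graft_def Let_def)

lemma worlds_graft_cases:
  assumes "u \<in> worlds (graft r ts bs)"
  obtains i where "u = prod_encode (0, i)" "i < length ts"
    | j v where "u = prod_encode (Suc j, v)" "j < length bs" "v \<in> worlds (bs ! j)"
  using assms by (auto simp: graft_def Let_def)

lemma access_graft:
  "(prod_encode (0, i), u) \<in> access (graft r ts bs) \<longleftrightarrow> i < length ts \<and> u \<in> worlds (graft r ts bs)"
  "(prod_encode (Suc j, v), u) \<in> access (graft r ts bs) \<longleftrightarrow>
     (\<exists>v'. u = prod_encode (Suc j, v') \<and> j < length bs \<and> (v, v') \<in> access (bs ! j))"
  by (auto simp: graft_def Let_def)

lemma tp_graft [simp]:
  "tp (graft r ts bs) (prod_encode (0, i)) = ts ! i"
  "tp (graft r ts bs) (prod_encode (Suc j, v)) = tp (bs ! j) v"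
  "rt (graft r ts bs) = prod_encode (0, r)"
  by (auto simp: graft_def Let_def)

lemma finite_graft:
  assumes "\<forall>b\<in>set bs. finite (worlds b)"
  shows "finite (worlds (graft r ts bs))"
proof -
  have "worlds (graft r ts bs) \<subseteq> (\<lambda>i. prod_encode (0, i)) ` {..<length ts} \<union>
      (\<Union>j<length bs. (\<lambda>v. prod_encode (Suc j, v)) ` worlds (bs ! j))"
    by (auto elim!: worlds_graft_cases)
  then show ?thesis
    by (rule finite_subset) (use assms in auto)
qed

text \<open>Conditions at the roots of the frames \<open>bs\<close> suffice: a root sees its whole
  frame, so a box true there reaches every world of the copy, and a box false there is refuted in
  the copy. The result is a tree because the copies are incomparable and the cluster lies below
  everything.\<close>

lemma graft_frame:
  assumes r: "r < length ts" and bs: "\<And>b. b \<in> set bs \<Longrightarrow> b \<in> fin_tree_frames \<phi>"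
    and ts: "\<And>s. s \<in> set ts \<Longrightarrow> is_type \<phi> s"
    and box1: "\<And>s s' \<psi>. s \<in> set ts \<Longrightarrow> s' \<in> set ts \<Longrightarrow> Box \<psi> \<in> s \<Longrightarrow> \<psi> \<in> s'"
    and box2: "\<And>s b \<psi>. s \<in> set ts \<Longrightarrow> b \<in> set bs \<Longrightarrow> Box \<psi> \<in> s \<Longrightarrow> Box \<psi> \<in> tp b (rt b)"
    and defect: "\<And>s \<psi>. s \<in> set ts \<Longrightarrow> \<psi> \<in> defects \<phi> s \<Longrightarrow>
      (\<exists>s'\<in>set ts. \<psi> \<notin> s') \<or> (\<exists>b\<in>set bs. Box \<psi> \<notin> tp b (rt b))"
  shows "graft r ts bs \<in> fin_tree_frames \<phi>"
proof -
  let ?g = "graft r ts bs"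
  have b: "bs ! j \<in> fin_tree_frames \<phi>" if "j < length bs" for j
    using bs that by simp
  note F = fin_tree_framesD[OF b] and FD = typed_frameD[OF fin_tree_framesD(1)[OF b]]
  have sub: "access ?g \<subseteq> worlds ?g \<times> worlds ?g"
  proof
    fix p
    assume "p \<in> access ?g"
    then show "p \<in> worlds ?g \<times> worlds ?g"
      using FD(1,2) by (auto simp: graft_def Let_def)
  qed
  have refl: "(u, u) \<in> access ?g" if "u \<in> worlds ?g" for u
    using that FD(3) by (cases rule: worlds_graft_cases) (auto simp: access_graft)
  have trans: "(u, w) \<in> access ?g" if "(u, v) \<in> access ?g" "(v, w) \<in> access ?g" for u v w
  proof -
    have "u \<in> worlds ?g" "w \<in> worlds ?g"
      using that sub by auto
    then show ?thesis
      using that FD(4) by (cases rule: worlds_graft_cases) (auto simp: access_graft)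
  qed
  have type: "is_type \<phi> (tp ?g u)" if "u \<in> worlds ?g" for u
    using that FD(5) ts by (cases rule: worlds_graft_cases) auto
  have box: "Box \<psi> \<in> tp ?g u \<longleftrightarrow> (\<forall>v. (u, v) \<in> access ?g \<longrightarrow> \<psi> \<in> tp ?g v)"
    if u: "u \<in> worlds ?g" and \<psi>: "Box \<psi> \<in> subpm \<phi>" for u \<psi>
    using u
  proof (cases rule: worlds_graft_cases)
    case (1 i)
    then have s: "ts ! i \<in> set ts"
      by simp
    have "\<psi> \<in> tp ?g v" if "Box \<psi> \<in> ts ! i" "v \<in> worlds ?g" for v
      using that(2)
    proof (cases rule: worlds_graft_cases)
      case (1 i')
      then show ?thesis
        using box1[OF s _ that(1)] by simp
    next
      case (2 j w)
      then have "Box \<psi> \<in> tp (bs ! j) (rt (bs ! j))"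
        using box2[OF s _ that(1)] by simp
      then show ?thesis
        using 2 FD(6)[OF 2(2) F(2)[OF 2(2)] \<psi>] F(3) by simp
    qed
    moreover have "\<exists>v\<in>worlds ?g. \<psi> \<notin> tp ?g v" if "Box \<psi> \<notin> ts ! i"
    proof -
      have "\<psi> \<in> defects \<phi> (ts ! i)"
        using that \<psi> by (simp add: defects_def)
      then consider i' where "i' < length ts" "\<psi> \<notin> ts ! i'"
        | j where "j < length bs" "Box \<psi> \<notin> tp (bs ! j) (rt (bs ! j))"
        using defect[OF s] by (metis in_set_conv_nth)
      then show ?thesis
      proof cases
        case 1
        then show ?thesis
          by (intro bexI[of _ "prod_encode (0, i')"]) auto
      next
        case 2
        then obtain v where "(rt (bs ! j), v) \<in> access (bs ! j)" "\<psi> \<notin> tp (bs ! j) v"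
          using FD(6)[OF 2(1) F(2)[OF 2(1)] \<psi>] by blast
        then show ?thesis
          using FD(2)[OF 2(1)] 2(1) by (intro bexI[of _ "prod_encode (Suc j, v)"]) auto
      qed
    qed
    ultimately show ?thesis
      using 1 by (auto simp: access_graft)
  next
    case (2 j w)
    then show ?thesis
      using FD(6)[OF 2(2,3) \<psi>] by (auto simp: access_graft)
  qed
  have tree: "(u, v) \<in> access ?g \<or> (v, u) \<in> access ?g"
    if uw: "(u, w) \<in> access ?g" and vw: "(v, w) \<in> access ?g" for u v w
  proof -
    have u: "u \<in> worlds ?g" and v: "v \<in> worlds ?g"
      using uw vw sub by auto
    show ?thesis
      using u
    proof (cases rule: worlds_graft_cases)
      case (1 i)
      then show ?thesis
        using v by (simp add: access_graft)
    next
      case u: (2 j u')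
      show ?thesis
        using v
      proof (cases rule: worlds_graft_cases)
        case (1 i)
        then show ?thesis
          using \<open>u \<in> worlds ?g\<close> by (simp add: access_graft)
      next
        case v: (2 k v')
        obtain w' where w': "w = prod_encode (Suc j, w')" "(u', w') \<in> access (bs ! j)"
          using uw u(1) by (auto simp: access_graft)
        then have "k = j" "(v', w') \<in> access (bs ! j)"
          using vw v(1) by (auto simp: access_graft)
        then show ?thesis
          using F(5)[OF u(2) w'(2), of v'] u v by (auto simp: access_graft)
      qed
    qed
  qed
  show ?thesis
  proof (rule fin_tree_framesI)
    show "typed_frame \<phi> ?g"
      unfolding typed_frame_def using sub type box
      by (blast intro: refl_onI transI refl trans)
    show "finite (worlds ?g)"
      using bs fin_tree_framesD(4) by (blast intro: finite_graft)
  qed (use r tree in \<open>auto simp: access_graft\<close>)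
qed

text \<open>The closure conditions serve twice: they make the assembled relation continuous, and
  through \<open>Box_point_type_closure\<close> they make boxes persist upwards. What closure cannot
  provide is a refutation for each failing box, so that remains a hypothesis.\<close>

lemma graft_simulated:
  assumes M: "dyn_top_model M" and r: "r < length ts"
    and bs: "\<And>b. b \<in> set bs \<Longrightarrow> b \<in> fin_tree_frames \<phi>"
    and A: "\<And>i. i < length ts \<Longrightarrow> A i \<noteq> {}" "\<And>i. i < length ts \<Longrightarrow> A i \<subseteq> topspace (mtop M)"
      "\<And>i x. i < length ts \<Longrightarrow> x \<in> A i \<Longrightarrow> point_type \<phi> M x = ts ! i"
    and clA: "\<And>i j. i < length ts \<Longrightarrow> j < length ts \<Longrightarrow> A i \<subseteq> mtop M closure_of A j"
    and clb: "\<And>i b. i < length ts \<Longrightarrow> b \<in> set bs \<Longrightarrow> A i \<subseteq> mtop M closure_of simulated \<phi> M b"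
    and defect: "\<And>s \<psi>. s \<in> set ts \<Longrightarrow> \<psi> \<in> defects \<phi> s \<Longrightarrow>
      (\<exists>s'\<in>set ts. \<psi> \<notin> s') \<or> (\<exists>b\<in>set bs. Box \<psi> \<notin> tp b (rt b))"
  shows "graft r ts bs \<in> fin_tree_frames \<phi> \<and> A r \<subseteq> simulated \<phi> M (graft r ts bs)"
proof -
  let ?g = "graft r ts bs"
  have g: "?g \<in> fin_tree_frames \<phi>"
  proof (rule graft_frame[OF r bs _ _ _ defect])
    fix s
    assume "s \<in> set ts"
    then obtain i where i: "i < length ts" "s = ts ! i"
      by (auto simp: in_set_conv_nth)
    \<comment> \<open>A point of \<open>A i\<close> realises \<open>ts ! i\<close>: this makes the
      entry a type and gives the boxes a point from which to persist.\<close>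
    obtain x where x: "x \<in> A i"
      using A(1)[OF i(1)] by auto
    show "is_type \<phi> s"
      using is_type_point_type[OF M, of x \<phi>] A(2)[OF i(1)] A(3)[OF i(1) x] x i by auto
    {
      fix s' \<psi>
      assume "s' \<in> set ts" and \<psi>: "Box \<psi> \<in> s"
      then obtain j where j: "j < length ts" "s' = ts ! j"
        by (auto simp: in_set_conv_nth)
      have "x \<in> mtop M closure_of A j"
        using clA[OF i(1) j(1)] x by blast
      then show "\<psi> \<in> s'"
        using Box_point_type_closure[of \<psi> \<phi> M x "A j" s'] A(3)[OF i(1) x] A(3)[OF j(1)] i j \<psi> by simp
    next
      fix b \<psi>
      assume b: "b \<in> set bs" and \<psi>: "Box \<psi> \<in> s"
      have c: "x \<in> mtop M closure_of simulated \<phi> M b"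
        using clb[OF i(1) b] x by blast
      have p: "Box \<psi> \<in> point_type \<phi> M x"
        using A(3)[OF i(1) x] i \<psi> by simp
      have "point_type \<phi> M y = tp b (rt b)" if "y \<in> simulated \<phi> M b" for y
        using that by (rule point_type_simulated)
      from Box_point_type_closure[OF p c this] show "Box \<psi> \<in> tp b (rt b)"
        by simp
    }
  qed
  define \<sigma> where "\<sigma> = {(prod_encode (0, i), x) | i x. i < length ts \<and> x \<in> A i} \<union>
    {(prod_encode (Suc j, v), x) | j v x. j < length bs \<and> (v, x) \<in> max_sim \<phi> (bs ! j) M}"
  have \<sigma>0: "(prod_encode (0, i), x) \<in> \<sigma> \<longleftrightarrow> i < length ts \<and> x \<in> A i" for i x
    by (auto simp: \<sigma>_def)
  have \<sigma>S: "(prod_encode (Suc j, v), x) \<in> \<sigma> \<longleftrightarrow> j < length bs \<and> (v, x) \<in> max_sim \<phi> (bs ! j) M"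
    for j v x
    by (auto simp: \<sigma>_def)
  have im: "\<sigma> `` {prod_encode (0, i)} = A i" if "i < length ts" for i
    using that \<sigma>0 by auto
  have imS: "\<sigma> `` {prod_encode (Suc j, v)} = max_sim \<phi> (bs ! j) M `` {v}" if "j < length bs" for j v
    using that \<sigma>S by auto
  have \<sigma>sub: "\<sigma> \<subseteq> worlds ?g \<times> topspace (mtop M)"
    using A(2) max_simD(1,2) unfolding \<sigma>_def by fastforce
  have "simulation \<phi> ?g M \<sigma>"
    unfolding simulation_iff
  proof (intro conjI allI impI)
    show "\<sigma> \<subseteq> worlds ?g \<times> topspace (mtop M)"
      by (rule \<sigma>sub)
  next
    fix u x v
    assume *: "(u, x) \<in> \<sigma> \<and> v \<in> worlds ?g \<and> (u, v) \<in> access ?g"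
    then have "u \<in> worlds ?g"
      using \<sigma>sub by auto
    then show "x \<in> mtop M closure_of (\<sigma> `` {v})"
    proof (cases rule: worlds_graft_cases)
      case (1 i)
      then have x: "x \<in> A i"
        using * \<sigma>0 by simp
      have "v \<in> worlds ?g"
        using * by simp
      then show ?thesis
      proof (cases rule: worlds_graft_cases)
        case (1 i')
        then show ?thesis
          using clA[OF \<open>i < length ts\<close> 1(2)] x by (auto simp: im)
      next
        case (2 j w)
        then have b: "bs ! j \<in> set bs"
          by simp
        \<comment> \<open>The root of \<open>bs ! j\<close> sees \<open>w\<close>, so points of the
          root are limits of points of \<open>w\<close>; since closures are idempotent, limits of
          root points are too.\<close>
        have "simulated \<phi> M (bs ! j) \<subseteq> mtop M closure_of (max_sim \<phi> (bs ! j) M `` {w})"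
          using fin_tree_framesD(3)[OF bs[OF b] 2(3)] 2(3)
          by (auto simp: simulated_def intro: max_simD(4))
        then have "mtop M closure_of simulated \<phi> M (bs ! j) \<subseteq>
            mtop M closure_of (max_sim \<phi> (bs ! j) M `` {w})"
          by (simp add: closure_of_minimal)
        then show ?thesis
          using clb[OF \<open>i < length ts\<close> b] x 2(1) imS[OF 2(2), of w] by auto
      qed
    next
      case (2 j w)
      then obtain w' where v: "v = prod_encode (Suc j, w')" "(w, w') \<in> access (bs ! j)"
        using * by (auto simp: access_graft)
      have "(w, x) \<in> max_sim \<phi> (bs ! j) M" "w' \<in> worlds (bs ! j)"
        using * 2 \<sigma>S v by auto
      then show ?thesis
        unfolding v(1) imS[OF 2(2)] using v(2) by (rule max_simD(4))
    qed
  next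
    fix u x
    assume *: "(u, x) \<in> \<sigma>"
    then have "u \<in> worlds ?g"
      using \<sigma>sub by auto
    then show "point_type \<phi> M x = tp ?g u"
    proof (cases rule: worlds_graft_cases)
      case (1 i)
      then show ?thesis
        using * A(3) \<sigma>0 by simp
    next
      case (2 j w)
      then have "(w, x) \<in> max_sim \<phi> (bs ! j) M"
        using * \<sigma>S by simp
      then show ?thesis
        using max_simD(3) 2 by simp
    qed
  qed
  then have "\<sigma> \<subseteq> max_sim \<phi> ?g M"
    by (rule max_sim_greatest)
  then show ?thesis
    using g r \<sigma>0 by (auto simp: simulated_def)
qed

section \<open>Covering coloured sets by finitely many frames\<close>

text \<open>Inside any open set, take a point where \<open>E\<close> has minimal cardinality.\<close>
lemma locally_constant_dense:
  assumes Q: "Q \<subseteq> topspace T" and fin: "finite I" and E: "\<And>x. E x \<subseteq> I"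
    and op: "\<And>i. i \<in> I \<Longrightarrow> openin T {x \<in> topspace T. i \<notin> E x}"
  shows "Q \<subseteq> T closure_of {x \<in> Q. \<exists>U. openin T U \<and> x \<in> U \<and> (\<forall>y\<in>U \<inter> Q. E y = E x)}"
    (is "_ \<subseteq> T closure_of ?G")
proof
  fix x
  assume x: "x \<in> Q"
  have "\<exists>z. z \<in> ?G \<and> z \<in> U" if U: "x \<in> U" "openin T U" for U
  proof -
    obtain z where z: "z \<in> U \<inter> Q" and min: "\<And>y. y \<in> U \<inter> Q \<Longrightarrow> card (E z) \<le> card (E y)"
      using ex_has_least_nat[of "\<lambda>y. y \<in> U \<inter> Q" x "\<lambda>y. card (E y)"] U x by auto
    \<comment> \<open>On \<open>V\<close> no index outside \<open>E z\<close> occurs, so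
      \<open>E\<close> can only shrink there, and minimality at \<open>z\<close> forbids that.
      \<open>topspace T\<close> keeps the intersected family nonempty.\<close>
    define V where "V = U \<inter> \<Inter>(insert (topspace T) ((\<lambda>i. {x \<in> topspace T. i \<notin> E x}) ` (I - E z)))"
    have "openin T V"
      unfolding V_def using U fin op by (intro openin_Int openin_Inter) auto
    moreover have "z \<in> V"
      using z Q by (auto simp: V_def)
    moreover have "E y = E z" if "y \<in> V \<inter> Q" for y
    proof (rule card_seteq)
      show "finite (E z)"
        using fin E finite_subset by blast
      show "E y \<subseteq> E z"
        using that E unfolding V_def by blast
      show "card (E z) \<le> card (E y)"
        using that min by (auto simp: V_def)
    qed
    ultimately show ?thesis
      using z by blast
  qed
  then show "x \<in> T closure_of ?G"
    unfolding in_closure_of using x Q by blast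
qed

text \<open>\<open>graft\<close> takes lists. Fixing one enumeration for each set keeps the number
  of candidate frames finite.\<close>

definition some_list :: "'a set \<Rightarrow> 'a list" where
  "some_list S = (SOME xs. set xs = S)"

lemma set_some_list: "finite S \<Longrightarrow> set (some_list S) = S"
  unfolding some_list_def by (rule someI_ex) (rule finite_list)

lemma closure_image:
  assumes "continuous_map T T' f" and "x \<in> T closure_of S" and "f ` S \<subseteq> S'"
  shows "f x \<in> T' closure_of S'"
  using assms continuous_map_image_closure_subset[OF assms(1), of S] closure_of_mono[OF assms(3)]
  by blast

text \<open>
  A pair \<open>(i, b)\<close> in \<open>F\<close> is a frame \<open>b\<close> with a label \<open>i\<close> that only \<open>P\<close> may depend on.
  The points of the sets \<open>Q k\<close> where the sets \<open>EK\<close> of colours and \<open>EF\<close> of frames seen in the limit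
  are locally constant fall into finitely many classes, and each class is simulated by a cluster
  with the colours of \<open>EK\<close> below the frames of \<open>EF\<close>. Since these points are dense, every point of
  \<open>Q k\<close> is simulated by a single world below one of these cluster frames.
\<close>
lemma finite_cover_by_grafts:
  fixes K :: "'k set" and Q :: "'k \<Rightarrow> 'x set" and F :: "('i \<times> (nat, 'p) lframe) set"
  assumes M: "dyn_top_model M" and f: "continuous_map (mtop M) (mtop M) f"
    and finK: "finite K" and finF: "finite F"
    and Q: "\<And>k. k \<in> K \<Longrightarrow> Q k \<subseteq> topspace (mtop M)"
    and ty: "\<And>k x. k \<in> K \<Longrightarrow> x \<in> Q k \<Longrightarrow> point_type \<phi> M (f x) = ty k"
    and F: "\<And>p. p \<in> F \<Longrightarrow> snd p \<in> fin_tree_frames \<phi>"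
    and EK: "\<And>x. EK x = {k \<in> K. x \<in> mtop M closure_of Q k}"
    and EF: "\<And>x. EF x = {p \<in> F. f x \<in> mtop M closure_of simulated \<phi> M (snd p)}"
    and W: "\<And>k x \<psi>. k \<in> K \<Longrightarrow> x \<in> Q k \<Longrightarrow> \<psi> \<in> defects \<phi> (ty k) \<Longrightarrow>
      (\<exists>p\<in>EF x. Box \<psi> \<notin> tp (snd p) (rt (snd p))) \<or>
      (\<forall>k'\<in>K. Box \<psi> \<notin> ty k') \<and> (\<exists>k'\<in>EK x. \<psi> \<notin> ty k')"
    and H1: "\<And>z cs bs r. z \<in> \<Union>(Q ` K) \<Longrightarrow> r < length cs \<Longrightarrow> set cs = EK z \<Longrightarrow> set bs = EF z \<Longrightarrow>
      P (cs ! r) (graft r (map ty cs) (map snd bs))"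
    and H2: "\<And>k k' b bs. k \<in> K \<Longrightarrow> k' \<in> K \<Longrightarrow> b \<in> fin_tree_frames \<phi> \<Longrightarrow>
      P k' b \<Longrightarrow> set bs \<subseteq> F \<Longrightarrow> P k (graft 0 [ty k] (b # map snd bs))"
    and k: "k \<in> K"
  obtains G where "finite G" "G \<subseteq> fin_tree_frames \<phi>" "\<And>b. b \<in> G \<Longrightarrow> P k b"
    "\<And>x. x \<in> Q k \<Longrightarrow> \<exists>b\<in>G. f x \<in> simulated \<phi> M b"
proof -
  let ?T = "mtop M" and ?Q = "\<Union>(Q ` K)"
  \<comment> \<open>A disjoint sum, so that a single appeal to \<open>locally_constant_dense\<close>
    makes both sets locally constant.\<close>
  define E where "E x = EK x <+> EF x" for x
  have E_iff: "E y = E x \<longleftrightarrow> EK y = EK x \<and> EF y = EF x" for x y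
    unfolding E_def by (auto simp: set_eq_iff Plus_def)
  define H where "H = {x \<in> ?Q. \<exists>U. openin ?T U \<and> x \<in> U \<and> (\<forall>y\<in>U \<inter> ?Q. E y = E x)}"
  have QT: "?Q \<subseteq> topspace ?T"
    using Q by blast
  have dense: "?Q \<subseteq> ?T closure_of H"
    unfolding H_def
  proof (rule locally_constant_dense[OF QT])
    show "finite (K <+> F)"
      using finK finF by simp
    show "E x \<subseteq> K <+> F" for x
      unfolding E_def EK EF by auto
    fix i
    assume "i \<in> K <+> F"
    then show "openin ?T {x \<in> topspace ?T. i \<notin> E x}"
    proof (elim PlusE)
      fix k
      assume "k \<in> K" "i = Inl k"
      then have "{x \<in> topspace ?T. i \<notin> E x} = topspace ?T - ?T closure_of Q k"
        unfolding E_def EK EF by auto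
      then show ?thesis
        by (simp add: openin_diff)
    next
      fix p
      assume "p \<in> F" "i = Inr p"
      then have "{x \<in> topspace ?T. i \<notin> E x} =
          {x \<in> topspace ?T. f x \<in> topspace ?T - ?T closure_of simulated \<phi> M (snd p)}"
        unfolding E_def EK EF using f by (auto simp: continuous_map_def)
      moreover have "openin ?T (topspace ?T - ?T closure_of simulated \<phi> M (snd p))"
        by (simp add: openin_diff)
      ultimately show ?thesis
        using openin_continuous_map_preimage[OF f] by (simp only:)
    qed
  qed
  define A where "A \<Gamma> \<Phi> k = {z \<in> H \<inter> Q k. EK z = \<Gamma> \<and> EF z = \<Phi>}" for \<Gamma> \<Phi> k
  \<comment> \<open>The mutual closure needed for a cluster. The neighbourhood that makes
    \<open>z\<close> generic also makes each coloured point in it generic, with the same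
    \<open>EK\<close> and \<open>EF\<close>; and \<open>z\<close> is a limit of \<open>Q k'\<close>
    as \<open>k'\<close> belongs to \<open>EK z\<close>.\<close>
  have A_closure: "z \<in> ?T closure_of A \<Gamma> \<Phi> k'" if z: "z \<in> A \<Gamma> \<Phi> k" and k': "k' \<in> \<Gamma>" for z \<Gamma> \<Phi> k k'
    unfolding in_closure_of
  proof (intro conjI allI impI)
    have zH: "z \<in> H" and EKz: "EK z = \<Gamma>" and EFz: "EF z = \<Phi>"
      using z by (auto simp: A_def)
    show "z \<in> topspace ?T"
      using zH QT by (auto simp: H_def)
    obtain U where U: "openin ?T U" "z \<in> U" and Ec: "\<And>y. y \<in> U \<inter> ?Q \<Longrightarrow> E y = E z"
      using zH by (auto simp: H_def)
    have k'K: "k' \<in> K" and zk': "z \<in> ?T closure_of Q k'"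
      using k' EKz by (auto simp: EK)
    fix V
    assume V: "z \<in> V \<and> openin ?T V"
    have "openin ?T (U \<inter> V)" "z \<in> U \<inter> V"
      using U V by auto
    then obtain y where y: "y \<in> Q k'" "y \<in> U \<inter> V"
      using zk' unfolding in_closure_of by blast
    have "y \<in> ?Q" "E y = E z"
      using y k'K Ec by auto
    then have "y \<in> H"
      unfolding H_def using U(1) y(2) Ec by (intro CollectI conjI exI[of _ U]) auto
    then have "y \<in> A \<Gamma> \<Phi> k'"
      using \<open>E y = E z\<close> EKz EFz y by (auto simp: A_def E_iff)
    then show "\<exists>y. y \<in> A \<Gamma> \<Phi> k' \<and> y \<in> V"
      using y(2) by blast
  qed
  define fr where "fr \<Gamma> \<Phi> r = graft r (map ty (some_list \<Gamma>)) (map snd (some_list \<Phi>))"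
    for \<Gamma> and \<Phi> :: "('i \<times> (nat, 'p) lframe) set" and r
  \<comment> \<open>Finiteness comes from the parameters: subsets of \<open>K\<close> and
    \<open>F\<close> and an index for the root. The filter then retains exactly what the later steps
    use.\<close>
  define B where "B = {b \<in> (\<lambda>(\<Gamma>, \<Phi>, r). fr \<Gamma> \<Phi> r) ` (SIGMA \<Gamma>:Pow K. Pow F \<times> {..<length (some_list \<Gamma>)}).
    b \<in> fin_tree_frames \<phi> \<and> (\<exists>k'\<in>K. P k' b \<and> tp b (rt b) = ty k')}"
  define G where "G = {b \<in> (\<lambda>(b, \<Phi>). graft 0 [ty k] (b # map snd (some_list \<Phi>))) ` (B \<times> Pow F).
    b \<in> fin_tree_frames \<phi> \<and> P k b}"
  have "finite (SIGMA \<Gamma>:Pow K. Pow F \<times> {..<length (some_list \<Gamma>)})"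
    using finK finF by (intro finite_SigmaI) auto
  then have "finite B"
    unfolding B_def by auto
  then have "finite G"
    unfolding G_def using finF by auto
  have cluster: "\<exists>b\<in>B. f ` A \<Gamma> \<Phi> k' \<subseteq> simulated \<phi> M b"
    if k': "k' \<in> K" and ne: "A \<Gamma> \<Phi> k' \<noteq> {}" for \<Gamma> \<Phi> k'
  proof -
    obtain z where z: "z \<in> A \<Gamma> \<Phi> k'"
      using ne by auto
    then have EKz: "EK z = \<Gamma>" and EFz: "EF z = \<Phi>" and zQ: "z \<in> Q k'"
      by (auto simp: A_def)
    have \<Gamma>K: "\<Gamma> \<subseteq> K" and \<Phi>F: "\<Phi> \<subseteq> F"
      using EKz EFz by (auto simp: EK EF)
    have set\<Gamma>: "set (some_list \<Gamma>) = \<Gamma>" and set\<Phi>: "set (some_list \<Phi>) = \<Phi>"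
      using finite_subset[OF \<Gamma>K finK] finite_subset[OF \<Phi>F finF] by (simp_all add: set_some_list)
    have "z \<in> ?T closure_of Q k'"
      using closure_of_subset[OF Q[OF k']] zQ by blast
    then have "k' \<in> set (some_list \<Gamma>)"
      using k' EKz by (auto simp: set\<Gamma> EK)
    then obtain r where r: "r < length (some_list \<Gamma>)" "some_list \<Gamma> ! r = k'"
      by (auto simp: in_set_conv_nth)
    have nth: "some_list \<Gamma> ! i \<in> \<Gamma>" if "i < length (some_list \<Gamma>)" for i
      using that set\<Gamma> nth_mem by blast
    define S where "S i = f ` A \<Gamma> \<Phi> (some_list \<Gamma> ! i)" for i
    have S: "\<exists>y. y \<in> A \<Gamma> \<Phi> (some_list \<Gamma> ! i)" if "i < length (some_list \<Gamma>)" for i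
      using A_closure[OF z nth[OF that]] by (metis in_closure_of openin_topspace)
    have fr: "fr \<Gamma> \<Phi> r \<in> fin_tree_frames \<phi> \<and> S r \<subseteq> simulated \<phi> M (fr \<Gamma> \<Phi> r)"
      unfolding fr_def
    proof (rule graft_simulated[OF M, of _ _ _ \<phi> S])
      fix i
      assume "i < length (map ty (some_list \<Gamma>))"
      then have i: "i < length (some_list \<Gamma>)"
        by simp
      let ?k = "some_list \<Gamma> ! i"
      have ik: "?k \<in> \<Gamma>" "?k \<in> K"
        using nth[OF i] \<Gamma>K by auto
      show "S i \<noteq> {}"
        using S[OF i] by (auto simp: S_def)
      show "S i \<subseteq> topspace ?T"
        using Q[OF ik(2)] f by (auto simp: S_def A_def continuous_map_def)
      show "point_type \<phi> M x = map ty (some_list \<Gamma>) ! i" if "x \<in> S i" for x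
        using that ty[OF ik(2)] i by (auto simp: S_def A_def)
      show "S i \<subseteq> ?T closure_of S j" if "j < length (map ty (some_list \<Gamma>))" for j
        using closure_image[OF f A_closure[OF _ nth[of j]], of _ \<Phi> _ "S j"] that
        by (auto simp: S_def)
      show "S i \<subseteq> ?T closure_of simulated \<phi> M b" if "b \<in> set (map snd (some_list \<Phi>))" for b
        using that by (auto simp: S_def A_def set\<Phi> EF)
    next
      fix s \<psi>
      assume s: "s \<in> set (map ty (some_list \<Gamma>))" and \<psi>: "\<psi> \<in> defects \<phi> s"
      then obtain i where i: "i < length (some_list \<Gamma>)" "s = ty (some_list \<Gamma> ! i)"
        by (auto simp: in_set_conv_nth)
      obtain y where y: "y \<in> A \<Gamma> \<Phi> (some_list \<Gamma> ! i)"
        using S[OF i(1)] by auto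
      then have "(\<exists>p\<in>EF y. Box \<psi> \<notin> tp (snd p) (rt (snd p))) \<or> (\<exists>k'\<in>EK y. \<psi> \<notin> ty k')"
        using W[of "some_list \<Gamma> ! i" y \<psi>] nth[OF i(1)] \<Gamma>K \<psi> i(2) by (auto simp: A_def)
      moreover have "EK y = \<Gamma>" "EF y = \<Phi>"
        using y by (auto simp: A_def)
      ultimately show "(\<exists>s'\<in>set (map ty (some_list \<Gamma>)). \<psi> \<notin> s') \<or>
          (\<exists>b\<in>set (map snd (some_list \<Phi>)). Box \<psi> \<notin> tp b (rt b))"
        by (auto simp: set\<Gamma> set\<Phi>)
    qed (use r F \<Phi>F set\<Phi> in auto)
    moreover have "P k' (fr \<Gamma> \<Phi> r)"
      using H1[of z r "some_list \<Gamma>" "some_list \<Phi>"] r zQ k' set\<Gamma> set\<Phi> EKz EFz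
      by (auto simp: fr_def)
    moreover have "tp (fr \<Gamma> \<Phi> r) (rt (fr \<Gamma> \<Phi> r)) = ty k'"
      using r by (simp add: fr_def)
    ultimately have "fr \<Gamma> \<Phi> r \<in> B"
      unfolding B_def using k' r(1) \<Gamma>K \<Phi>F by (auto intro!: image_eqI[of _ _ "(\<Gamma>, \<Phi>, r)"])
    then show ?thesis
      using fr r(2) by (auto simp: S_def)
  qed
  have "\<exists>b\<in>G. f x \<in> simulated \<phi> M b" if x: "x \<in> Q k" for x
  proof -
    have fin: "finite (Pow K \<times> Pow F \<times> K)"
      using finK finF by simp
    \<comment> \<open>Finitely many classes exhaust the generic points, so \<open>x\<close> is a
      limit of one class and \<open>f x\<close> a limit of the points simulated by one frame of
      \<open>B\<close>.\<close>
    have "H \<subseteq> (\<Union>(\<Gamma>, \<Phi>, k')\<in>Pow K \<times> Pow F \<times> K. A \<Gamma> \<Phi> k')"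
    proof
      fix z
      assume "z \<in> H"
      moreover obtain k' where "k' \<in> K" "z \<in> Q k'"
        using calculation by (auto simp: H_def)
      ultimately show "z \<in> (\<Union>(\<Gamma>, \<Phi>, k')\<in>Pow K \<times> Pow F \<times> K. A \<Gamma> \<Phi> k')"
        by (intro UN_I[of "(EK z, EF z, k')"]) (auto simp: A_def EK EF)
    qed
    moreover have "x \<in> ?T closure_of H"
      using dense x k by blast
    ultimately have "x \<in> ?T closure_of (\<Union>(\<Gamma>, \<Phi>, k')\<in>Pow K \<times> Pow F \<times> K. A \<Gamma> \<Phi> k')"
      using closure_of_mono by blast
    then obtain q where "q \<in> Pow K \<times> Pow F \<times> K" "x \<in> ?T closure_of (case q of (\<Gamma>, \<Phi>, k') \<Rightarrow> A \<Gamma> \<Phi> k')"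
      by (rule closure_of_Union_finite[OF fin])
    then obtain \<Gamma> \<Phi> k' where k': "k' \<in> K" and xA: "x \<in> ?T closure_of A \<Gamma> \<Phi> k'"
      by (cases q) auto
    have "A \<Gamma> \<Phi> k' \<noteq> {}"
      using xA by auto
    then obtain b where b: "b \<in> B" and Ab: "f ` A \<Gamma> \<Phi> k' \<subseteq> simulated \<phi> M b"
      using cluster[OF k'] by blast
    have fxb: "f x \<in> ?T closure_of simulated \<phi> M b"
      using closure_image[OF f xA Ab] .
    have bfin: "b \<in> fin_tree_frames \<phi>"
      using b by (simp add: B_def)
    obtain k'' where k'': "k'' \<in> K" "P k'' b" "tp b (rt b) = ty k''"
      using b by (auto simp: B_def)
    have EFF: "EF x \<subseteq> F"
      by (auto simp: EF)
    have EFcl: "f x \<in> ?T closure_of simulated \<phi> M (snd p)" if "p \<in> EF x" for p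
      using that by (simp add: EF)
    have setE: "set (some_list (EF x)) = EF x"
      using finite_subset[OF EFF finF] by (rule set_some_list)
    let ?g = "graft 0 [ty k] (b # map snd (some_list (EF x)))"
    have "?g \<in> fin_tree_frames \<phi> \<and> {f x} \<subseteq> simulated \<phi> M ?g"
    proof (rule graft_simulated[OF M, of _ _ _ \<phi> "\<lambda>_. {f x}"])
      have fx: "f x \<in> topspace ?T"
        using x Q[OF k] f by (auto simp: continuous_map_def)
      then show "{f x} \<subseteq> topspace ?T"
        by simp
      show "{f x} \<subseteq> ?T closure_of {f x}"
        using closure_of_subset[of "{f x}" ?T] fx by simp
      show "b' \<in> fin_tree_frames \<phi>" if "b' \<in> set (b # map snd (some_list (EF x)))" for b'
        using that b F EFF by (auto simp: setE B_def)
      show "{f x} \<subseteq> ?T closure_of simulated \<phi> M b'" if "b' \<in> set (b # map snd (some_list (EF x)))" for b'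
        using that fxb EFcl by (auto simp: setE)
      \<comment> \<open>The single new world has no cluster mates to refute a box. A failing box
        without a witness among the frames of \<open>EF x\<close> fails, by \<open>W\<close>, in all
        colours, hence at the root of \<open>b\<close>, whose type is \<open>ty k''\<close>.\<close>
      show "(\<exists>s'\<in>set [ty k]. \<psi> \<notin> s') \<or>
          (\<exists>b\<in>set (b # map snd (some_list (EF x))). Box \<psi> \<notin> tp b (rt b))"
        if "s \<in> set [ty k]" "\<psi> \<in> defects \<phi> s" for s \<psi>
        using W[OF k x, of \<psi>] that k'' by (auto simp: setE)
    qed (use ty[OF k x] in auto)
    moreover have "P k ?g"
      using H2[OF k k''(1) bfin k''(2), of "some_list (EF x)"] x EFF by (auto simp: setE)
    ultimately have "?g \<in> G"
      unfolding G_def using b EFF by (auto intro!: image_eqI[of _ _ "(b, EF x)"])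
    then show ?thesis
      using \<open>?g \<in> fin_tree_frames \<phi> \<and> {f x} \<subseteq> simulated \<phi> M ?g\<close> by blast
  qed
  moreover have "b \<in> fin_tree_frames \<phi> \<and> P k b" if "b \<in> G" for b
    using that unfolding G_def by blast
  ultimately show thesis
    using that[of G] \<open>finite G\<close> by blast
qed

section \<open>Every point is simulated\<close>

text \<open>Boxes true at \<open>x\<close> persist to the type \<open>s\<close>, so types seen in
  the limit never have a new failing box. This drives the induction on defects.\<close>

lemma defects_closure_subset:
  assumes "x \<in> mtop M closure_of {y \<in> topspace (mtop M). point_type \<phi> M y = s}"
  shows "defects \<phi> s \<subseteq> defects \<phi> (point_type \<phi> M x)"
  using Box_point_type_closure[OF _ assms] unfolding defects_def by blast

lemma Box_notin_if_notin:
  assumes "b \<in> fin_tree_frames \<phi>" and "Box \<psi> \<in> subpm \<phi>" and "\<psi> \<notin> tp b (rt b)"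
  shows "Box \<psi> \<notin> tp b (rt b)"
  using typed_frameD(3,6)[OF fin_tree_framesD(1,2)[OF assms(1)]] assms by blast

text \<open>Turns a finite cover of the points of \<open>S\<close> into one frame of type
  \<open>s\<close> that is seen in the limit from \<open>x\<close>.\<close>

lemma closure_simulated_cover:
  assumes "finite G" and "x \<in> mtop M closure_of S"
    and "\<And>y. y \<in> S \<Longrightarrow> \<exists>b\<in>G. y \<in> simulated \<phi> M b \<and> tp b (rt b) = point_type \<phi> M y"
    and "\<And>y. y \<in> S \<Longrightarrow> point_type \<phi> M y = s"
  obtains b where "b \<in> G" "x \<in> mtop M closure_of simulated \<phi> M b" "tp b (rt b) = s"
proof -
  let ?G = "{b \<in> G. tp b (rt b) = s}"
  have "S \<subseteq> (\<Union>b\<in>?G. simulated \<phi> M b)"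
    using assms(3,4) by fastforce
  then have "x \<in> mtop M closure_of (\<Union>b\<in>?G. simulated \<phi> M b)"
    using assms(2) closure_of_mono by blast
  then show thesis
    by (rule closure_of_Union_finite[rotated]) (use that assms(1) in auto)
qed

text \<open>The grafting step with the identity map and a trivial \<open>P\<close>. The colours are
  the types with exactly the failing boxes of \<open>s\<close>; the earlier frames are those found
  for types with fewer. A type refuting a box near a point of colour \<open>k\<close> has no
  additional defects, so it is either a colour or already covered.\<close>

lemma finite_cover_of_type:
  assumes M: "dyn_top_model M"
  shows "s \<in> Pow (subpm \<phi>) \<Longrightarrow> \<exists>G. finite G \<and> G \<subseteq> fin_tree_frames \<phi> \<and>
    (\<forall>x\<in>topspace (mtop M). point_type \<phi> M x = s \<longrightarrow> (\<exists>b\<in>G. x \<in> simulated \<phi> M b))"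
proof (induction "card (defects \<phi> s)" arbitrary: s rule: less_induct)
  case less
  let ?X = "topspace (mtop M)"
  let ?L = "{s' \<in> Pow (subpm \<phi>). card (defects \<phi> s') < card (defects \<phi> s)}"
  let ?C = "\<lambda>s' G. finite G \<and> G \<subseteq> fin_tree_frames \<phi> \<and>
    (\<forall>x\<in>?X. point_type \<phi> M x = s' \<longrightarrow> (\<exists>b\<in>G. x \<in> simulated \<phi> M b))"
  have "\<forall>s'\<in>?L. \<exists>G. ?C s' G"
    by (intro ballI less.hyps) auto
  from bchoice[OF this] obtain g where g0: "\<forall>s'\<in>?L. ?C s' (g s')"
    by (elim exE)
  note g = bspec[OF g0]
  define F where "F = Pair () ` (\<Union>s'\<in>?L. g s')"
  define K where "K = {s' \<in> Pow (subpm \<phi>). defects \<phi> s' = defects \<phi> s}"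
  define Q where "Q s' = {x \<in> ?X. point_type \<phi> M x = s'}" for s'
  have finP: "finite (Pow (subpm \<phi>))"
    using finite_subpm by simp
  show ?case
  proof (rule finite_cover_by_grafts[OF M, of "\<lambda>x. x" K F Q \<phi> "\<lambda>s. s" _ _ "\<lambda>_ _. True" s])
    show "finite K"
      using finP unfolding K_def by simp
    show "finite F"
      unfolding F_def using finP g by (intro finite_imageI finite_UN_I) auto
    show "snd p \<in> fin_tree_frames \<phi>" if "p \<in> F" for p
    proof -
      from that obtain s' where "s' \<in> ?L" "snd p \<in> g s'"
        unfolding F_def by auto
      then show ?thesis
        using g[of s'] by blast
    qed
    show "s \<in> K"
      using less.prems by (simp add: K_def)
    fix k x \<psi>
    assume k: "k \<in> K" and x: "x \<in> Q k" and \<psi>: "\<psi> \<in> defects \<phi> k"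
    have xX: "x \<in> ?X" and tx: "point_type \<phi> M x = k"
      using x by (auto simp: Q_def)
    obtain s' where s': "s' \<in> Pow (subpm \<phi>)" "\<psi> \<notin> s'" and xs': "x \<in> mtop M closure_of Q s'"
      using defect_point_type_closure[OF M xX, of \<psi> \<phi>] \<psi> tx unfolding Q_def by metis
    have sub: "defects \<phi> s' \<subseteq> defects \<phi> s"
      using defects_closure_subset[of x M \<phi> s'] xs' k tx by (simp add: K_def Q_def)
    show "(\<exists>p\<in>{p \<in> F. x \<in> mtop M closure_of simulated \<phi> M (snd p)}. Box \<psi> \<notin> tp (snd p) (rt (snd p))) \<or>
        (\<forall>k'\<in>K. Box \<psi> \<notin> k') \<and> (\<exists>k'\<in>{k \<in> K. x \<in> mtop M closure_of Q k}. \<psi> \<notin> k')"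
    \<comment> \<open>With equal defects the witness \<open>s'\<close> is itself a colour, and the
      box fails in all of \<open>K\<close>; with fewer, the induction hypothesis supplies a
      frame.\<close>
    proof (cases "defects \<phi> s' = defects \<phi> s")
      case True
      have "Box \<psi> \<notin> k'" if "k' \<in> K" for k'
      proof -
        have "\<psi> \<in> defects \<phi> k'"
          using that k \<psi> by (simp add: K_def)
        then show ?thesis
          by (simp add: defects_def)
      qed
      then show ?thesis
        using True s' xs' by (auto simp: K_def)
    next
      case False
      then have s'L: "s' \<in> ?L"
        using sub s'(1) psubset_card_mono[OF finite_defects[of \<phi> s]] by blast
      note gs = g[OF s'L]
      have cover: "\<exists>b\<in>g s'. y \<in> simulated \<phi> M b \<and> tp b (rt b) = point_type \<phi> M y" if "y \<in> Q s'" for y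
        using gs that point_type_simulated unfolding Q_def by fastforce
      obtain b where b: "b \<in> g s'" "x \<in> mtop M closure_of simulated \<phi> M b" "tp b (rt b) = s'"
        by (rule closure_simulated_cover[OF conjunct1[OF gs] xs' cover]) (auto simp: Q_def)
      have "Box \<psi> \<notin> tp b (rt b)"
      proof (rule Box_notin_if_notin)
        show "b \<in> fin_tree_frames \<phi>"
          using gs b(1) by blast
        show "Box \<psi> \<in> subpm \<phi>"
          using \<psi> by (simp add: defects_def)
      qed (use b(3) s'(2) in simp)
      moreover have "((), b) \<in> F"
        unfolding F_def using b(1) s'L by blast
      ultimately show ?thesis
        using b(2) by fastforce
    qed
  qed (use M in \<open>auto simp: Q_def\<close>)
qed

lemma finite_cover:
  assumes M: "dyn_top_model M"
  obtains G where "finite G" "G \<subseteq> fin_tree_frames \<phi>"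
    "\<And>x. x \<in> topspace (mtop M) \<Longrightarrow> \<exists>b\<in>G. x \<in> simulated \<phi> M b"
proof -
  let ?X = "topspace (mtop M)"
  let ?C = "\<lambda>s G. finite G \<and> G \<subseteq> fin_tree_frames \<phi> \<and>
    (\<forall>x\<in>?X. point_type \<phi> M x = s \<longrightarrow> (\<exists>b\<in>G. x \<in> simulated \<phi> M b))"
  have "\<forall>s\<in>Pow (subpm \<phi>). \<exists>G. ?C s G"
    by (intro ballI finite_cover_of_type[OF M])
  from bchoice[OF this] obtain g where g0: "\<forall>s\<in>Pow (subpm \<phi>). ?C s (g s)"
    by (elim exE)
  note g = bspec[OF g0]
  show thesis
  proof (rule that[of "\<Union>s\<in>Pow (subpm \<phi>). g s"])
    show "finite (\<Union>s\<in>Pow (subpm \<phi>). g s)"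
      using g finite_subpm by (intro finite_UN_I) auto
    show "(\<Union>s\<in>Pow (subpm \<phi>). g s) \<subseteq> fin_tree_frames \<phi>"
      using g by (intro UN_least) simp
    fix x
    assume "x \<in> ?X"
    then obtain b where b: "b \<in> g (point_type \<phi> M x)" "x \<in> simulated \<phi> M b"
      using g[OF point_type_Pow, of M x] by auto
    show "\<exists>b\<in>\<Union>s\<in>Pow (subpm \<phi>). g s. x \<in> simulated \<phi> M b"
      using b(2) UN_I[where B = g, OF point_type_Pow b(1)] by (rule bexI)
  qed
qed

section \<open>Arrows follow the dynamics\<close>

text \<open>
  The non-confluent sensible relations from the subframe \<open>\<aa>\<^sup>w\<close> to \<open>\<bb>\<close>, without reference to
  \<open>\<aa>\<^sup>w\<close>: the conditions force the domain to be the up-set of \<open>w\<close>.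
\<close>
definition arrow_from :: "'p fm \<Rightarrow> ('w, 'p) lframe \<Rightarrow> 'w \<Rightarrow> ('v, 'p) lframe \<Rightarrow> ('w \<times> 'v) set \<Rightarrow> bool" where
  "arrow_from \<phi> a w b g \<longleftrightarrow>
     g \<subseteq> worlds a \<times> worlds b \<and> (w, rt b) \<in> g \<and>
     (\<forall>(u, v) \<in> g. sensible_pair \<phi> (tp a u) (tp b v)) \<and>
     (\<forall>u v u'. (u, v) \<in> g \<and> (u, u') \<in> access a \<longrightarrow> (\<exists>v'. (v, v') \<in> access b \<and> (u', v') \<in> g)) \<and>
     (\<forall>u v u' v'. (u, v) \<in> g \<and> (u', v') \<in> g \<and> (v, v') \<in> access b \<longrightarrow> (u, u') \<in> access a)"

lemma arrow_from_root:
  assumes a: "a \<in> fin_tree_frames \<phi>" and b: "b \<in> fin_tree_frames \<phi>"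
    and g: "arrow_from \<phi> a (rt a) b g"
  shows "arrows \<phi> a b"
  unfolding arrows_def sensible_def continuous_rel_up_up_iff[OF fin_tree_framesD(1)[OF b]]
proof (intro exI[of _ g] conjI)
  show "\<forall>w\<in>worlds a. g `` {w} \<noteq> {}"
    using g fin_tree_framesD(3)[OF a] unfolding arrow_from_def by blast
qed (use g in \<open>unfold arrow_from_def, blast+\<close>)

text \<open>Cluster world \<open>i\<close> is related to \<open>ws ! i\<close> alone, and a copy
  labelled \<open>Some w\<close> inherits an arrow from \<open>w\<close>. Copies labelled
  \<open>None\<close> only refute boxes and receive no pairs; this is harmless, since continuity
  lifts edges of \<open>a\<close>, not of the target. Non-confluence survives because copies are
  incomparable and each \<open>ws ! i\<close> sees the labels.\<close>

lemma arrow_from_graft: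
  assumes r: "r < length ws" and len: "length ts = length ws"
    and a: "typed_frame \<phi> a"
    and ws: "\<And>i i'. i < length ws \<Longrightarrow> i' < length ws \<Longrightarrow> (ws ! i, ws ! i') \<in> access a"
    and sens: "\<And>i. i < length ws \<Longrightarrow> sensible_pair \<phi> (tp a (ws ! i)) (ts ! i)"
    and b: "\<And>w b. (Some w, b) \<in> set bs \<Longrightarrow> (\<exists>g. arrow_from \<phi> a w b g)"
    and fr: "\<And>p. p \<in> set bs \<Longrightarrow> snd p \<in> fin_tree_frames \<phi>"
    and up: "\<And>i w b. i < length ws \<Longrightarrow> (Some w, b) \<in> set bs \<Longrightarrow> (ws ! i, w) \<in> access a"
    and cover: "\<And>i u. i < length ws \<Longrightarrow> (ws ! i, u) \<in> access a \<Longrightarrow>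
      u \<in> set ws \<or> (\<exists>w b. (Some w, b) \<in> set bs \<and> (w, u) \<in> access a)"
  shows "\<exists>g. arrow_from \<phi> a (ws ! r) (graft r ts (map snd bs)) g"
proof -
  let ?g = "graft r ts (map snd bs)"
  note T = typed_frameD[OF a]
  define lab where "lab j w \<longleftrightarrow> j < length bs \<and> fst (bs ! j) = Some w" for j w
  have lab_in: "(Some w, snd (bs ! j)) \<in> set bs" if "lab j w" for j w
    using that nth_mem[of j bs] by (cases "bs ! j") (auto simp: lab_def)
  have "\<forall>j w. lab j w \<longrightarrow> (\<exists>h. arrow_from \<phi> a w (snd (bs ! j)) h)"
    using b lab_in by blast
  then obtain h where h: "\<And>j w. lab j w \<Longrightarrow> arrow_from \<phi> a w (snd (bs ! j)) (h j w)"
    by metis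
  have hsub: "u \<in> worlds a" "v \<in> worlds (snd (bs ! j))"
    and hsens: "sensible_pair \<phi> (tp a u) (tp (snd (bs ! j)) v)"
    if "lab j w" "(u, v) \<in> h j w" for j w u v
    using h[OF that(1)] that(2) unfolding arrow_from_def by blast+
  have hcont: "\<exists>v'. (v, v') \<in> access (snd (bs ! j)) \<and> (u', v') \<in> h j w"
    if "lab j w" "(u, v) \<in> h j w" "(u, u') \<in> access a" for j w u v u'
    using h[OF that(1)] that(2,3) unfolding arrow_from_def by blast
  have hconf: "(u, u') \<in> access a"
    if "lab j w" "(u, v) \<in> h j w" "(u', v') \<in> h j w" "(v, v') \<in> access (snd (bs ! j))" for j w u v u' v'
    using h[OF that(1)] that(2-) unfolding arrow_from_def by blast
  have hroot: "(w, rt (snd (bs ! j))) \<in> h j w" if "lab j w" for j w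
    using h[OF that] unfolding arrow_from_def by blast
  have hup: "(w, u) \<in> access a" if "lab j w" "(u, v) \<in> h j w" for j w u v
    using hconf[OF that(1) hroot[OF that(1)] that(2)] hsub[OF that]
      fin_tree_framesD(3)[OF fr[OF lab_in[OF that(1)]]] by simp
  have lab_uniq: "w = w'" if "lab j w" "lab j w'" for j w w'
    using that by (simp add: lab_def)
  define G where "G = {(ws ! i, prod_encode (0, i)) | i. i < length ws} \<union>
    {(u, prod_encode (Suc j, v)) | u j v. \<exists>w. lab j w \<and> (u, v) \<in> h j w}"
  have G0: "(u, prod_encode (0, i)) \<in> G \<longleftrightarrow> i < length ws \<and> u = ws ! i" for u i
    by (auto simp: G_def)
  have GS: "(u, prod_encode (Suc j, v)) \<in> G \<longleftrightarrow> (\<exists>w. lab j w \<and> (u, v) \<in> h j w)" for u j v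
    by (auto simp: G_def)
  have Gsub: "G \<subseteq> worlds a \<times> worlds ?g"
  proof
    fix p
    assume "p \<in> G"
    then consider i where "i < length ws" "p = (ws ! i, prod_encode (0, i))"
      | u j v w where "lab j w" "(u, v) \<in> h j w" "p = (u, prod_encode (Suc j, v))"
      unfolding G_def by blast
    then show "p \<in> worlds a \<times> worlds ?g"
    proof cases
      case 1
      then show ?thesis
        using T(1)[OF ws[OF 1(1) 1(1)]] len by simp
    next
      case 2
      then show ?thesis
        using hsub[OF 2(1,2)] by (simp add: lab_def)
    qed
  qed
  have sensG: "sensible_pair \<phi> (tp a u) (tp ?g v)" if uv: "(u, v) \<in> G" for u v
  proof -
    have "v \<in> worlds ?g"
      using Gsub uv by blast
    then show ?thesis
    proof (cases rule: worlds_graft_cases)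
      case (1 i)
      then show ?thesis
        using uv sens G0 by simp
    next
      case (2 j x)
      then obtain w where "lab j w" "(u, x) \<in> h j w"
        using uv GS by auto
      then show ?thesis
        using hsens[of j w u x] 2 by (simp add: lab_def)
    qed
  qed
  have contG: "\<exists>v'. (v, v') \<in> access ?g \<and> (u', v') \<in> G" if uv: "(u, v) \<in> G" and uu: "(u, u') \<in> access a"
    for u v u'
  proof -
    have "v \<in> worlds ?g"
      using Gsub uv by blast
    then show ?thesis
    proof (cases rule: worlds_graft_cases)
      case (1 i)
      then have i: "i < length ws" "u = ws ! i"
        using uv G0 by auto
      have "(ws ! i, u') \<in> access a"
        using uu i(2) by simp
      from cover[OF i(1) this] have "\<exists>v'\<in>worlds ?g. (u', v') \<in> G"
      proof (elim disjE exE conjE)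
        assume "u' \<in> set ws"
        then obtain i' where "i' < length ws" "u' = ws ! i'"
          by (auto simp: in_set_conv_nth)
        then show ?thesis
          using G0 len by (intro bexI[of _ "prod_encode (0, i')"]) auto
      next
        fix w b
        assume "(Some w, b) \<in> set bs" and wu: "(w, u') \<in> access a"
        then obtain j where "j < length bs" "bs ! j = (Some w, b)"
          by (auto simp: in_set_conv_nth)
        then have j: "lab j w"
          by (simp add: lab_def)
        obtain v' where v': "(u', v') \<in> h j w"
          using hcont[OF j hroot[OF j] wu] by blast
        then have "(u', prod_encode (Suc j, v')) \<in> G"
          using j GS by blast
        then show ?thesis
          using Gsub by blast
      qed
      then show ?thesis
        using 1 by (auto simp: access_graft)
    next
      case (2 j x)
      then obtain w where j: "lab j w" and x: "(u, x) \<in> h j w"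
        using uv GS by auto
      obtain v' where "(x, v') \<in> access (snd (bs ! j))" "(u', v') \<in> h j w"
        using hcont[OF j x uu] by blast
      then show ?thesis
        using 2 j GS by (intro exI[of _ "prod_encode (Suc j, v')"]) (auto simp: access_graft)
    qed
  qed
  have confG: "(u, u') \<in> access a"
    if uv: "(u, v) \<in> G" and uv': "(u', v') \<in> G" and vv: "(v, v') \<in> access ?g" for u v u' v'
  proof -
    have v: "v \<in> worlds ?g" and v': "v' \<in> worlds ?g"
      using Gsub uv uv' by auto
    show ?thesis
      using v
    proof (cases rule: worlds_graft_cases)
      case (1 i)
      then have i: "i < length ws" "u = ws ! i"
        using uv G0 by auto
      show ?thesis
        using v'
      proof (cases rule: worlds_graft_cases)
        case (1 i')
        then show ?thesis
          using uv' G0 ws i by simp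
      next
        case (2 j x)
        then obtain w where j: "lab j w" and x: "(u', x) \<in> h j w"
          using uv' GS by auto
        show ?thesis
          using T(4)[OF up[OF i(1) lab_in[OF j]] hup[OF j x]] i by simp
      qed
    next
      case (2 j x)
      then obtain w where j: "lab j w" and x: "(u, x) \<in> h j w"
        using uv GS by auto
      obtain x' where x': "v' = prod_encode (Suc j, x')" "(x, x') \<in> access (snd (bs ! j))"
        using vv 2 by (auto simp: access_graft)
      \<comment> \<open>A copy has one label only, so both pairs come from the same relation
        \<open>h j w\<close>.\<close>
      have "(u', x') \<in> h j w"
        using uv' GS lab_uniq[OF j] unfolding x'(1) by blast
      then show ?thesis
        using hconf[OF j x _ x'(2)] by blast
    qed
  qed
  have "(ws ! r, rt ?g) \<in> G"
    using r G0 by simp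
  then have "arrow_from \<phi> a (ws ! r) ?g G"
    unfolding arrow_from_def using Gsub sensG contG confG by blast
  then show ?thesis
    by blast
qed

lemma arrows_iff_arrow_from:
  assumes a: "a \<in> fin_tree_frames \<phi>" and b: "b \<in> fin_tree_frames \<phi>"
  shows "arrows \<phi> a b \<longleftrightarrow> (\<exists>g. arrow_from \<phi> a (rt a) b g)"
proof
  assume "arrows \<phi> a b"
  then obtain g where g: "sensible \<phi> a b g" "(rt a, rt b) \<in> g"
    "\<forall>w v w' v'. (w, v) \<in> g \<and> (w', v') \<in> g \<and> (v, v') \<in> access b \<longrightarrow> (w, w') \<in> access a"
    unfolding arrows_def by blast
  have "arrow_from \<phi> a (rt a) b g"
    unfolding arrow_from_def
  proof (intro conjI allI impI)
    fix u v u'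
    assume "(u, v) \<in> g \<and> (u, u') \<in> access a"
    then show "\<exists>v'. (v, v') \<in> access b \<and> (u', v') \<in> g"
      using g(1) typed_frameD(2)[OF fin_tree_framesD(1)[OF a]]
      unfolding sensible_def continuous_rel_up_up_iff[OF fin_tree_framesD(1)[OF b]] by blast
  qed (use g in \<open>unfold sensible_def continuous_rel_up_up_iff[OF fin_tree_framesD(1)[OF b]], blast+\<close>)
  then show "\<exists>g. arrow_from \<phi> a (rt a) b g"
    by blast
qed (use arrow_from_root[OF a b] in blast)

text \<open>Keep the pairs of \<open>g\<close> whose target lies above \<open>v\<close>:
  non-confluence forces their sources above \<open>w\<close>. This yields continuity of the arrow
  relation between classes.\<close>

lemma arrows_restrict_at:
  assumes a: "a \<in> fin_tree_frames \<phi>" and b: "b \<in> fin_tree_frames \<phi>"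
    and g: "arrow_from \<phi> a u b g" and wv: "(w, v) \<in> g"
  shows "arrows \<phi> (restrict_at a w) (restrict_at b v)"
proof -
  note Ta = typed_frameD(1-4)[OF fin_tree_framesD(1)[OF a]]
  note Tb = typed_frameD(1-4)[OF fin_tree_framesD(1)[OF b]]
  have sub: "g \<subseteq> worlds a \<times> worlds b"
    and sens: "\<And>x y. (x, y) \<in> g \<Longrightarrow> sensible_pair \<phi> (tp a x) (tp b y)"
    and cont: "\<And>x y x'. (x, y) \<in> g \<Longrightarrow> (x, x') \<in> access a \<Longrightarrow> \<exists>y'. (y, y') \<in> access b \<and> (x', y') \<in> g"
    and conf: "\<And>x y x' y'. (x, y) \<in> g \<Longrightarrow> (x', y') \<in> g \<Longrightarrow> (y, y') \<in> access b \<Longrightarrow> (x, x') \<in> access a"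
    using g unfolding arrow_from_def by blast+
  have w: "w \<in> worlds a" and v: "v \<in> worlds b"
    using wv sub by auto
  define h where "h = {(x, y) \<in> g. (v, y) \<in> access b}"
  have h: "(x, y) \<in> h \<longleftrightarrow> (x, y) \<in> g \<and> (v, y) \<in> access b" for x y
    by (simp add: h_def)
  have "arrow_from \<phi> (restrict_at a w) (rt (restrict_at a w)) (restrict_at b v) h"
    unfolding arrow_from_def
  proof (intro conjI allI impI)
    show "h \<subseteq> worlds (restrict_at a w) \<times> worlds (restrict_at b v)"
      using sub conf[OF wv] by (auto simp: h)
    show "(rt (restrict_at a w), rt (restrict_at b v)) \<in> h"
      using wv v Tb(3) by (simp add: h)
    show "\<forall>(x, y)\<in>h. sensible_pair \<phi> (tp (restrict_at a w) x) (tp (restrict_at b v) y)"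
      using sens by (auto simp: h)
  next
    fix x y x'
    assume "(x, y) \<in> h \<and> (x, x') \<in> access (restrict_at a w)"
    then have xy: "(x, y) \<in> g" "(v, y) \<in> access b" and xx: "(x, x') \<in> access a"
      by (auto simp: h)
    obtain y' where y': "(y, y') \<in> access b" "(x', y') \<in> g"
      using cont[OF xy(1) xx] by blast
    have "(v, y') \<in> access b" "y \<in> worlds b" "y' \<in> worlds b"
      using Tb(4)[OF xy(2) y'(1)] Tb(1,2)[OF y'(1)] by auto
    then show "\<exists>y'. (y, y') \<in> access (restrict_at b v) \<and> (x', y') \<in> h"
      using y' xy(2) by (intro exI[of _ y']) (simp add: h)
  next
    fix x y x' y'
    assume *: "(x, y) \<in> h \<and> (x', y') \<in> h \<and> (y, y') \<in> access (restrict_at b v)"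
    then have "(x, x') \<in> access a"
      using conf[of x y x' y'] by (simp add: h)
    moreover have "(w, x) \<in> access a" "(w, x') \<in> access a"
      using * conf[OF wv] by (auto simp: h)
    ultimately show "(x, x') \<in> access (restrict_at a w)"
      using Ta(2) by auto
  qed
  then show ?thesis
    by (rule arrow_from_root[OF restrict_at_fin_tree_frames[OF a w] restrict_at_fin_tree_frames[OF b v]])
qed

text \<open>The worlds of the cluster of \<open>w\<close> must be treated together, since an arrow
  from one has to reach images of all the others; hence they appear as colours. The worlds in
  \<open>L\<close> lie strictly above and are covered by induction, with their arrows recorded in
  the labels. \<open>F0\<close> is added to refute boxes at \<open>f x\<close>.\<close>

lemma finite_cover_arrow_from:
  fixes M :: "('x, 'p) dtmodel" and a :: "(nat, 'p) lframe"
  assumes M: "dyn_top_model M" and a: "a \<in> fin_tree_frames \<phi>"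
  shows "w \<in> worlds a \<Longrightarrow> \<exists>G. finite G \<and> G \<subseteq> fin_tree_frames \<phi> \<and>
    (\<forall>b\<in>G. \<exists>g. arrow_from \<phi> a w b g) \<and>
    (\<forall>x\<in>max_sim \<phi> a M `` {w}. \<exists>b\<in>G. mfun M x \<in> simulated \<phi> M b)"
proof (induction "card {v. (w, v) \<in> access a}" arbitrary: w rule: less_induct)
  case less
  let ?X = "topspace (mtop M)" and ?f = "mfun M"
  let ?S = "\<lambda>w. max_sim \<phi> a M `` {w}"
  note T = typed_frameD(1-4)[OF fin_tree_framesD(1)[OF a]]
  have f: "continuous_map (mtop M) (mtop M) ?f"
    using M by (simp add: dyn_top_model_def)
  have fX: "?f x \<in> ?X" if "x \<in> ?X" for x
    using f that by (auto simp: continuous_map_def)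
  define L where "L = {u. (w, u) \<in> access a \<and> (u, w) \<notin> access a}"
  let ?C = "\<lambda>u G. finite G \<and> G \<subseteq> fin_tree_frames \<phi> \<and>
    (\<forall>b\<in>G. \<exists>g. arrow_from \<phi> a u b g) \<and>
    (\<forall>x\<in>?S u. \<exists>b\<in>G. ?f x \<in> simulated \<phi> M b)"
  have "\<exists>G. ?C u G" if u: "u \<in> L" for u
  proof (rule less.hyps)
    have wu: "(w, u) \<in> access a" "(u, w) \<notin> access a"
      using u by (auto simp: L_def)
    have "{v. (u, v) \<in> access a} \<subset> {v. (w, v) \<in> access a}"
      using T(4)[OF wu(1)] T(3)[OF less.prems] wu(2) by blast
    moreover have "finite {v. (w, v) \<in> access a}"
      by (rule finite_subset[OF _ fin_tree_framesD(4)[OF a]]) (use T(2) in blast)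
    ultimately show "card {v. (u, v) \<in> access a} < card {v. (w, v) \<in> access a}"
      by (rule psubset_card_mono[rotated])
    show "u \<in> worlds a"
      using T(2)[OF wu(1)] .
  qed
  then have "\<forall>u\<in>L. \<exists>G. ?C u G"
    by (rule ballI)
  from bchoice[OF this] obtain g where g0: "\<forall>u\<in>L. ?C u (g u)"
    by (elim exE)
  note g = bspec[OF g0]
  have finL: "finite L"
    by (rule finite_subset[OF _ fin_tree_framesD(4)[OF a]]) (auto simp: L_def dest: T(2))
  obtain F0 where F0: "finite F0" "F0 \<subseteq> fin_tree_frames \<phi>"
    "\<And>x. x \<in> ?X \<Longrightarrow> \<exists>b\<in>F0. x \<in> simulated \<phi> M b"
    using finite_cover[OF M] by blast
  define F where "F = Pair None ` F0 \<union> (\<Union>u\<in>L. Pair (Some u) ` g u)"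
  define Q where "Q k = {x \<in> ?S (fst k). point_type \<phi> M (?f x) = snd k}" for k
  \<comment> \<open>A point of \<open>Q k\<close> witnesses that the type of the world and the type
    in the colour form a sensible pair; hence the demand that \<open>Q k\<close> be
    nonempty.\<close>
  define K where "K = {k. (w, fst k) \<in> access a \<and> (fst k, w) \<in> access a \<and>
    snd k \<in> Pow (subpm \<phi>) \<and> Q k \<noteq> {}}"
  define EK where "EK x = {k \<in> K. x \<in> mtop M closure_of Q k}" for x
  define EF where "EF x = {p \<in> F. ?f x \<in> mtop M closure_of simulated \<phi> M (snd p)}" for x
  let ?P = "\<lambda>k b. \<exists>h. arrow_from \<phi> a (fst k) b h"
  have SX: "?S u \<subseteq> ?X" for u
    using max_simD(2) by fast
  have Fcases: "(\<exists>b\<in>F0. p = (None, b)) \<or> (\<exists>u\<in>L. \<exists>b\<in>g u. p = (Some u, b))" if "p \<in> F" for p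
    using that unfolding F_def by auto
  have FL: "u \<in> L" "b \<in> g u" if "(Some u, b) \<in> F" for u b
    using Fcases[OF that] by auto
  have Ffin: "snd p \<in> fin_tree_frames \<phi>" if "p \<in> F" for p
  proof -
    have "(\<Union>u\<in>L. g u) \<subseteq> fin_tree_frames \<phi>"
      using g by (intro UN_least) simp
    then show ?thesis
      using Fcases[OF that] F0(2) by auto
  qed
  have Farrow: "\<exists>h. arrow_from \<phi> a u b h" if "(Some u, b) \<in> F" for u b
    using g[OF FL(1)[OF that]] FL(2)[OF that] by blast
  have finF: "finite F"
    unfolding F_def using F0(1) finL g by (intro finite_UnI finite_imageI finite_UN_I) auto
  have finK: "finite K"
  proof (rule finite_subset)
    show "K \<subseteq> worlds a \<times> Pow (subpm \<phi>)"
      using T(2) by (auto simp: K_def)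
    show "finite (worlds a \<times> Pow (subpm \<phi>))"
      using fin_tree_framesD(4)[OF a] by (simp add: finite_subpm)
  qed
  have S_closure: "x \<in> mtop M closure_of ?S v" if "x \<in> ?S u" "(u, v) \<in> access a" for x u v
    using max_simD(4)[of u x \<phi> a M v] that T(2) by blast
  have sens: "sensible_pair \<phi> (tp a (fst k)) (snd k)" if "k \<in> K" for k
  proof -
    from that obtain x where x: "x \<in> Q k"
      unfolding K_def by blast
    then have "(fst k, x) \<in> max_sim \<phi> a M" and "point_type \<phi> M (?f x) = snd k"
      by (auto simp: Q_def)
    then show ?thesis
      using sensible_pair_point_type[OF M max_simD(2), of "fst k" x \<phi> a \<phi>] max_simD(3) by metis
  qed
  \<comment> \<open>Every world above the cluster needs an image in the graft. Within the cluster,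
    \<open>z\<close> is a limit of one of finitely many colours at \<open>u\<close>; strictly above,
    \<open>f z\<close> is by continuity a limit of points simulated by a frame labelled
    \<open>Some u\<close>.\<close>
  have cover: "u \<in> fst ` EK z \<or> (\<exists>v b. (Some v, b) \<in> EF z \<and> (v, u) \<in> access a)"
    if z: "z \<in> Q k" and k: "k \<in> K" and ku: "(fst k, u) \<in> access a" for z k u
  proof -
    have wu: "(w, u) \<in> access a"
      using T(4)[of w "fst k" u] k ku by (simp add: K_def)
    have zS: "z \<in> mtop M closure_of ?S u"
      using S_closure[of z "fst k" u] z ku by (simp add: Q_def)
    show ?thesis
    proof (cases "(u, w) \<in> access a")
      case True
      have "?S u \<subseteq> (\<Union>s\<in>Pow (subpm \<phi>). Q (u, s))"
      proof
        fix y
        assume "y \<in> ?S u"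
        then have "y \<in> Q (u, point_type \<phi> M (?f y))"
          by (simp add: Q_def)
        then show "y \<in> (\<Union>s\<in>Pow (subpm \<phi>). Q (u, s))"
          by (rule UN_I[OF point_type_Pow])
      qed
      then have "z \<in> mtop M closure_of (\<Union>s\<in>Pow (subpm \<phi>). Q (u, s))"
        using zS closure_of_mono by blast
      then obtain s where s: "s \<in> Pow (subpm \<phi>)" "z \<in> mtop M closure_of Q (u, s)"
        by (rule closure_of_Union_finite[rotated]) (simp_all add: finite_subpm)
      then have "Q (u, s) \<noteq> {}"
        by auto
      then have "(u, s) \<in> EK z"
        using s wu True by (simp add: EK_def K_def)
      then show ?thesis
        by force
    next
      case False
      then have u: "u \<in> L"
        using wu by (simp add: L_def)
      note gu = g[OF u]
      have "?f z \<in> mtop M closure_of (\<Union>b\<in>g u. simulated \<phi> M b)"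
        by (rule closure_image[OF f zS]) (use gu in auto)
      then obtain b where b: "b \<in> g u" "?f z \<in> mtop M closure_of simulated \<phi> M b"
        by (rule closure_of_Union_finite[rotated]) (use gu in simp_all)
      then have "(Some u, b) \<in> EF z"
        using u by (auto simp: EF_def F_def)
      then show ?thesis
        using T(3)[OF T(2)[OF wu]] by blast
    qed
  qed
  have clK: "(fst k, fst k') \<in> access a" if "k \<in> K" "k' \<in> K" for k k'
    using that T(4)[of "fst k" w "fst k'"] by (simp add: K_def)
  have KL: "(fst k, u) \<in> access a" if "k \<in> K" "u \<in> L" for k u
    using that T(4)[of "fst k" w u] by (simp add: K_def L_def)
  have H1: "?P (cs ! r) (graft r (map snd cs) (map snd bs))"
    if z: "z \<in> \<Union>(Q ` K)" and r: "r < length cs" and cs: "set cs = EK z" and bs: "set bs = EF z"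
    for z cs bs r
  proof -
    have csK: "cs ! i \<in> K" if "i < length cs" for i
      using nth_mem[OF that] cs by (simp add: EK_def)
    have bsF: "p \<in> F" if "p \<in> set bs" for p
      using that bs by (simp add: EF_def)
    obtain k where k: "k \<in> K" "z \<in> Q k"
      using z by blast
    have "\<exists>h. arrow_from \<phi> a (map fst cs ! r) (graft r (map snd cs) (map snd bs)) h"
    proof (rule arrow_from_graft[OF _ _ fin_tree_framesD(1)[OF a]])
      fix i u
      assume i: "i < length (map fst cs)" and u: "(map fst cs ! i, u) \<in> access a"
      have "(fst k, u) \<in> access a"
        using T(4)[OF clK[OF k(1) csK[of i]], of u] i u by simp
      from cover[OF k(2,1) this]
      show "u \<in> set (map fst cs) \<or> (\<exists>v b. (Some v, b) \<in> set bs \<and> (v, u) \<in> access a)"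
        by (simp add: cs bs)
    next
      fix i v b
      assume "i < length (map fst cs)" "(Some v, b) \<in> set bs"
      then show "(map fst cs ! i, v) \<in> access a"
        using KL[OF csK FL(1)[OF bsF]] by simp
    qed (use r csK clK sens bsF Farrow Ffin in simp_all)
    then show ?thesis
      using r by simp
  qed
  \<comment> \<open>\<open>b\<close> is entered from \<open>fst k'\<close> in the same cluster, so
    its arrow already provides images for everything that \<open>fst k\<close> sees.\<close>
  have H2: "?P k (graft 0 [snd k] (b # map snd bs))"
    if k: "k \<in> K" and k': "k' \<in> K" and b: "b \<in> fin_tree_frames \<phi>" and P: "?P k' b"
      and bs: "set bs \<subseteq> F" for k k' b bs
  proof -
    have "\<exists>h. arrow_from \<phi> a ([fst k] ! 0) (graft 0 [snd k] (map snd ((Some (fst k'), b) # bs))) h"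
    proof (rule arrow_from_graft[OF _ _ fin_tree_framesD(1)[OF a]])
      fix v c
      assume "(Some v, c) \<in> set ((Some (fst k'), b) # bs)"
      then show "\<exists>h. arrow_from \<phi> a v c h"
        using P Farrow bs by auto
    next
      fix i v c
      assume "i < length [fst k]" "(Some v, c) \<in> set ((Some (fst k'), b) # bs)"
      then show "([fst k] ! i, v) \<in> access a"
        using clK[OF k k'] KL[OF k] FL(1)[of v c] bs by auto
    next
      fix i u
      assume "i < length [fst k]" "([fst k] ! i, u) \<in> access a"
      then have "(fst k', u) \<in> access a"
        using T(4)[OF clK[OF k' k]] by simp
      then show "u \<in> set [fst k] \<or>
          (\<exists>v c. (Some v, c) \<in> set ((Some (fst k'), b) # bs) \<and> (v, u) \<in> access a)"
        by auto
    next
      fix p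
      assume "p \<in> set ((Some (fst k'), b) # bs)"
      then show "snd p \<in> fin_tree_frames \<phi>"
        using b Ffin[of p] bs by (cases "p \<in> set bs") auto
    qed (use clK[OF k k] sens[OF k] in simp_all)
    then show ?thesis
      by simp
  qed
  \<comment> \<open>The first alternative always holds: \<open>F0\<close> covers the whole space, so
    a type refuting the box near \<open>f x\<close> is seen through one of its frames.\<close>
  have W: "\<exists>p\<in>EF x. Box \<psi> \<notin> tp (snd p) (rt (snd p))"
    if x: "x \<in> Q k" and \<psi>: "\<psi> \<in> defects \<phi> (snd k)" for k x \<psi>
  proof -
    have fx: "?f x \<in> ?X" and tx: "point_type \<phi> M (?f x) = snd k"
      using x SX fX by (auto simp: Q_def)
    obtain s where s: "\<psi> \<notin> s"
      and xs: "?f x \<in> mtop M closure_of {y \<in> ?X. point_type \<phi> M y = s}"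
      using defect_point_type_closure[OF M fx, of \<psi> \<phi>] \<psi> tx by metis
    have F0y: "\<exists>b\<in>F0. y \<in> simulated \<phi> M b \<and> tp b (rt b) = point_type \<phi> M y"
      if "y \<in> {y \<in> ?X. point_type \<phi> M y = s}" for y
      using F0(3)[of y] that point_type_simulated by fastforce
    obtain b where b: "b \<in> F0" "?f x \<in> mtop M closure_of simulated \<phi> M b" "tp b (rt b) = s"
      by (rule closure_simulated_cover[OF F0(1) xs F0y]) auto
    have "Box \<psi> \<notin> tp b (rt b)"
    proof (rule Box_notin_if_notin)
      show "b \<in> fin_tree_frames \<phi>"
        using F0(2) b(1) by blast
      show "Box \<psi> \<in> subpm \<phi>"
        using \<psi> by (simp add: defects_def)
    qed (use b(3) s in simp)
    moreover have "(None, b) \<in> EF x"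
      using b by (simp add: EF_def F_def)
    ultimately show ?thesis
      by force
  qed
  have step: "\<exists>G. finite G \<and> G \<subseteq> fin_tree_frames \<phi> \<and> (\<forall>b\<in>G. ?P k b) \<and>
      (\<forall>x\<in>Q k. \<exists>b\<in>G. ?f x \<in> simulated \<phi> M b)" if k: "k \<in> K" for k
  proof (rule finite_cover_by_grafts[OF M f finK finF, of Q \<phi> snd EK EF ?P k])
    show "Q k \<subseteq> ?X" for k
      using SX by (auto simp: Q_def)
    show "point_type \<phi> M (?f x) = snd k" if "x \<in> Q k" for k x
      using that by (simp add: Q_def)
  next
    fix G
    assume "finite G" "G \<subseteq> fin_tree_frames \<phi>" "\<And>b. b \<in> G \<Longrightarrow> ?P k b"
      "\<And>x. x \<in> Q k \<Longrightarrow> \<exists>b\<in>G. ?f x \<in> simulated \<phi> M b"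
    then show ?thesis
      by (intro exI[of _ G]) simp
  next
    fix k x \<psi>
    assume "x \<in> Q k" "\<psi> \<in> defects \<phi> (snd k)"
    from W[OF this]
    show "(\<exists>p\<in>EF x. Box \<psi> \<notin> tp (snd p) (rt (snd p))) \<or>
        (\<forall>k'\<in>K. Box \<psi> \<notin> snd k') \<and> (\<exists>k'\<in>EK x. \<psi> \<notin> snd k')" ..
  qed (fact Ffin EK_def EF_def H1 H2 k)+
  \<comment> \<open>Colours at other worlds of the cluster have done their work inside the grafts;
    only those at \<open>w\<close> contribute frames to its cover.\<close>
  let ?K = "{k \<in> K. fst k = w}"
  have "\<forall>k\<in>?K. \<exists>G. finite G \<and> G \<subseteq> fin_tree_frames \<phi> \<and> (\<forall>b\<in>G. ?P k b) \<and>
      (\<forall>x\<in>Q k. \<exists>b\<in>G. ?f x \<in> simulated \<phi> M b)"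
    by (intro ballI step) simp
  from bchoice[OF this] obtain h where h0: "\<forall>k\<in>?K. finite (h k) \<and> h k \<subseteq> fin_tree_frames \<phi> \<and>
      (\<forall>b\<in>h k. ?P k b) \<and> (\<forall>x\<in>Q k. \<exists>b\<in>h k. ?f x \<in> simulated \<phi> M b)"
    by (elim exE)
  note h = bspec[OF h0]
  show ?case
  proof (intro exI[of _ "\<Union>k\<in>?K. h k"] conjI ballI)
    show "finite (\<Union>k\<in>?K. h k)"
      using finK h by (intro finite_UN_I) simp_all
    show "(\<Union>k\<in>?K. h k) \<subseteq> fin_tree_frames \<phi>"
      using h by (intro UN_least) simp
  next
    fix b
    assume "b \<in> (\<Union>k\<in>?K. h k)"
    then obtain k where k: "k \<in> ?K" "b \<in> h k"
      by (elim UN_E)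
    then show "\<exists>g. arrow_from \<phi> a w b g"
      using h[OF k(1)] by simp
  next
    fix x
    assume x: "x \<in> ?S w"
    let ?k = "(w, point_type \<phi> M (?f x))"
    have xQ: "x \<in> Q ?k"
      using x by (simp add: Q_def)
    then have k: "?k \<in> ?K"
      using point_type_Pow[of \<phi> M "?f x"] T(3)[OF less.prems] by (auto simp: K_def)
    then obtain b where b: "b \<in> h ?k" "?f x \<in> simulated \<phi> M b"
      using h[OF k] xQ by blast
    show "\<exists>b\<in>\<Union>k\<in>?K. h k. ?f x \<in> simulated \<phi> M b"
      using b(2) UN_I[where B = h, OF k b(1)] by (rule bexI)
  qed
qed

lemma arrows_simulated:
  assumes M: "dyn_top_model M" and a: "a \<in> fin_tree_frames \<phi>" and x: "x \<in> simulated \<phi> M a"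
  obtains b where "b \<in> fin_tree_frames \<phi>" "arrows \<phi> a b" "mfun M x \<in> simulated \<phi> M b"
proof -
  obtain G where G: "G \<subseteq> fin_tree_frames \<phi>" "\<And>b. b \<in> G \<Longrightarrow> \<exists>g. arrow_from \<phi> a (rt a) b g"
    "\<And>x. x \<in> max_sim \<phi> a M `` {rt a} \<Longrightarrow> \<exists>b\<in>G. mfun M x \<in> simulated \<phi> M b"
    using finite_cover_arrow_from[OF M a fin_tree_framesD(2)[OF a]] by blast
  obtain b where b: "b \<in> G" "mfun M x \<in> simulated \<phi> M b"
    using G(3)[of x] x by (auto simp: simulated_def)
  then show thesis
    using that[of b] G(1,2) arrows_iff_arrow_from[OF a] by blast
qed

section \<open>The quotient\<close>

lemma typed_frame_restrict_qmodel:
  assumes F: "typed_frame \<phi> Q" and D: "D \<subseteq> worlds Q"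
    and up: "\<And>u v. u \<in> D \<Longrightarrow> (u, v) \<in> access Q \<Longrightarrow> v \<in> D"
  shows "typed_frame \<phi> (restrict_qmodel Q D)"
proof -
  note T = typed_frameD[OF F]
  have "Box \<psi> \<in> tp Q u \<longleftrightarrow> (\<forall>v. (u, v) \<in> access Q \<inter> D \<times> D \<longrightarrow> \<psi> \<in> tp Q v)"
    if "u \<in> D" "Box \<psi> \<in> subpm \<phi>" for u \<psi>
    using T(6)[of u \<psi>] that D up by blast
  moreover have "refl_on (worlds Q \<inter> D) (access Q \<inter> D \<times> D)"
    by (rule refl_onI) (use T(3) in blast)
  moreover have "trans (access Q \<inter> D \<times> D)"
    by (rule transI) (use T(4) in blast)
  ultimately show ?thesis
    unfolding typed_frame_def restrict_qmodel_def using T(1,2,5) by auto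
qed

theorem theorem6p9:
  fixes \<phi> :: "'p fm" and M :: "('x, 'p) dtmodel"
  assumes "dyn_top_model M"
    and "truth_set M \<phi> \<noteq> {}"
  shows "quasimodel \<phi> (model_quotient M \<phi>) \<and> satisfied_in \<phi> (model_quotient M \<phi>)"
proof -
  note M = assms(1)
  let ?Q = "model_quotient M \<phi>" and ?I = "I_omega \<phi>"
  define D where "D = {A \<in> I_worlds \<phi>. chi_star \<phi> M `` {A} \<noteq> {}}"
  have Q: "?Q = restrict_qmodel ?I D"
    by (simp add: model_quotient_def D_def I_omega_def)
  have DI: "D \<subseteq> I_worlds \<phi>"
    by (auto simp: D_def)
  have Q_simps: "worlds ?Q = D" "access ?Q = I_succeq \<phi> \<inter> D \<times> D" "tp ?Q = I_type"
    "transit ?Q = I_arrows \<phi> \<inter> D \<times> D"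
    using DI unfolding Q by (auto simp: restrict_qmodel_def I_omega_def)
  have D_iff: "iso_class \<phi> a \<in> D \<longleftrightarrow> simulated \<phi> M a \<noteq> {}" if "a \<in> fin_tree_frames \<phi>" for a
    using that chi_star_iff[OF that, of _ M] by (auto simp: D_def I_worlds_eq)
  have up: "B \<in> D" if A: "A \<in> D" and AB: "(A, B) \<in> I_succeq \<phi>" for A B
  proof -
    obtain x where "(A, x) \<in> max_sim \<phi> ?I M"
      using A by (auto simp: D_def chi_star_eq)
    moreover have "B \<in> worlds ?I" "(A, B) \<in> access ?I"
      using AB by (auto simp: I_omega_def I_succeq_def)
    \<comment> \<open>The empty set has empty closure, so a limit point shows that \<open>B\<close>
      simulates something.\<close>
    ultimately have "x \<in> mtop M closure_of (max_sim \<phi> ?I M `` {B})"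
      by (rule max_simD(4))
    then have "max_sim \<phi> ?I M `` {B} \<noteq> {}"
      by auto
    then show ?thesis
      using \<open>B \<in> worlds ?I\<close> by (simp add: D_def chi_star_eq I_omega_def)
  qed
  have frame: "typed_frame \<phi> ?Q"
    unfolding Q by (rule typed_frame_restrict_qmodel[OF typed_frame_I_omega])
      (use DI up in \<open>auto simp: I_omega_def\<close>)
  have arrow_reps: "\<exists>a b g. a \<in> fin_tree_frames \<phi> \<and> b \<in> fin_tree_frames \<phi> \<and>
      A = iso_class \<phi> a \<and> B = iso_class \<phi> b \<and> arrow_from \<phi> a (rt a) b g"
    if "(A, B) \<in> I_arrows \<phi>" for A B
  proof -
    from that obtain a b where "A \<in> I_worlds \<phi>" "B \<in> I_worlds \<phi>" "a \<in> A" "b \<in> B" "arrows \<phi> a b"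
      by (auto simp: I_arrows_def)
    moreover note I_worlds_rep[OF this(1,3)] I_worlds_rep[OF this(2,4)]
    ultimately show ?thesis
      using arrows_iff_arrow_from[of a \<phi> b] by blast
  qed
  have arrowI: "(iso_class \<phi> a, iso_class \<phi> b) \<in> I_arrows \<phi>"
    if "a \<in> fin_tree_frames \<phi>" "b \<in> fin_tree_frames \<phi>" "arrows \<phi> a b" for a b
    using that iso_class_self[of _ \<phi>] unfolding I_arrows_def I_worlds_eq by blast
  have sens: "sensible_pair \<phi> (I_type A) (I_type B)" if "(A, B) \<in> I_arrows \<phi>" for A B
  proof -
    obtain a b g where "a \<in> fin_tree_frames \<phi>" "b \<in> fin_tree_frames \<phi>"
      "A = iso_class \<phi> a" "B = iso_class \<phi> b" "arrow_from \<phi> a (rt a) b g"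
      using arrow_reps[OF \<open>(A, B) \<in> I_arrows \<phi>\<close>] by blast
    then show ?thesis
      by (auto simp: I_type_iso_class arrow_from_def)
  qed
  \<comment> \<open>Used twice: it gives every class in \<open>D\<close> an outgoing arrow inside
    \<open>D\<close>, and iterated it shadows an orbit of the model.\<close>
  have follow: "\<exists>B\<in>D. (A, B) \<in> I_arrows \<phi> \<and> (B, mfun M x) \<in> chi_star \<phi> M"
    if "A \<in> D" and Ax: "(A, x) \<in> chi_star \<phi> M" for A x
  proof -
    obtain a where a: "a \<in> fin_tree_frames \<phi>" and A: "A = iso_class \<phi> a"
      using \<open>A \<in> D\<close> by (auto simp: D_def I_worlds_eq)
    have "x \<in> simulated \<phi> M a"
      using Ax chi_star_iff[OF a, of x M] by (simp add: A)
    then obtain b where b: "b \<in> fin_tree_frames \<phi>" "arrows \<phi> a b" "mfun M x \<in> simulated \<phi> M b"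
      using arrows_simulated[OF M a] by blast
    then show ?thesis
      using arrowI[OF a b(1,2)] D_iff[OF b(1)] chi_star_iff[OF b(1), of "mfun M x" M]
      by (intro bexI[of _ "iso_class \<phi> b"]) (auto simp: A)
  qed
  \<comment> \<open>The restricted arrow stays inside \<open>D\<close>: its target is a subframe of
    \<open>B\<close>, and \<open>D\<close> is closed under subframes.\<close>
  have cont: "\<exists>B'. (B, B') \<in> I_succeq \<phi> \<inter> D \<times> D \<and> (A', B') \<in> I_arrows \<phi> \<inter> D \<times> D"
    if AB: "(A, B) \<in> I_arrows \<phi>" "B \<in> D" and A': "A' \<in> D" "(A, A') \<in> I_succeq \<phi>" for A B A'
  proof -
    obtain a b g where a: "a \<in> fin_tree_frames \<phi>" and b: "b \<in> fin_tree_frames \<phi>"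
      and A: "A = iso_class \<phi> a" and B: "B = iso_class \<phi> b" and g: "arrow_from \<phi> a (rt a) b g"
      using arrow_reps[OF AB(1)] by blast
    obtain w where w: "w \<in> worlds a" and A'w: "A' = iso_class \<phi> (restrict_at a w)"
      using A'(2) I_succeq_iff[OF a] unfolding A by blast
    obtain v where wv: "(w, v) \<in> g"
      using g fin_tree_framesD(3)[OF a w] unfolding arrow_from_def by blast
    then have v: "v \<in> worlds b"
      using g unfolding arrow_from_def by blast
    have "(A', iso_class \<phi> (restrict_at b v)) \<in> I_arrows \<phi>"
      unfolding A'w using arrows_restrict_at[OF a b g wv] restrict_at_fin_tree_frames a b w v
      by (intro arrowI) auto
    moreover have "(B, iso_class \<phi> (restrict_at b v)) \<in> I_succeq \<phi>"
      unfolding B I_succeq_iff[OF b] using v by blast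
    ultimately show ?thesis
      using up[OF AB(2)] AB(2) A'(1) by blast
  qed
  have "sensible \<phi> ?Q ?Q (transit ?Q)"
    unfolding sensible_def continuous_rel_up_up_iff[OF frame] Q_simps
  proof (intro conjI allI impI ballI)
    fix A
    assume "A \<in> D"
    moreover obtain x where "(A, x) \<in> chi_star \<phi> M"
      using \<open>A \<in> D\<close> by (auto simp: D_def)
    ultimately show "(I_arrows \<phi> \<inter> D \<times> D) `` {A} \<noteq> {}"
      using follow[of A x] by blast
  next
    fix p
    assume "p \<in> I_arrows \<phi> \<inter> D \<times> D"
    then show "case p of (A, B) \<Rightarrow> sensible_pair \<phi> (I_type A) (I_type B)"
      using sens by (cases p) simp
  qed (use cont in auto)
  moreover have "neg (Star \<psi>) \<in> I_type A \<longleftrightarrow>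
      (\<exists>B\<in>D. \<exists>N. (A, B) \<in> (I_arrows \<phi> \<inter> D \<times> D) ^^ N \<and> neg \<psi> \<in> I_type B)"
    if \<psi>: "Star \<psi> \<in> subfms \<phi>" and A: "A \<in> D" for \<psi> A
  proof -
    have type: "is_type \<phi> (I_type B)" if "B \<in> D" for B
      using typed_frameD(5)[OF frame, of B] that by (simp add: Q_simps)
    have negS: "neg (Star \<psi>) \<in> I_type B \<longleftrightarrow> Star \<psi> \<notin> I_type B"
      and neg\<psi>: "neg \<psi> \<in> I_type B \<longleftrightarrow> \<psi> \<notin> I_type B" if "B \<in> D" for B
      using type_neg_iff[OF type[OF that]] subfms_subpm \<psi> subfms_immediate(5)[OF \<psi>] by blast+
    show ?thesis
    proof
      assume "neg (Star \<psi>) \<in> I_type A"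
      then have nS: "Star \<psi> \<notin> I_type A"
        using negS[OF A] by simp
      obtain x where Ax: "(A, x) \<in> chi_star \<phi> M"
        using A by (auto simp: D_def)
      have chi: "point_type \<phi> M y = I_type B" "y \<in> topspace (mtop M)" if "(B, y) \<in> chi_star \<phi> M" for B y
        using max_simD(2,3)[of B y \<phi> ?I M] that by (simp_all add: chi_star_eq I_omega_def)
      \<comment> \<open>An orbit of \<open>x\<close> is followed by equally many arrows, so a moment
        where \<open>\<psi>\<close> fails in the model is reached in the quotient.\<close>
      have path: "\<exists>B\<in>D. (A, B) \<in> (I_arrows \<phi> \<inter> D \<times> D) ^^ n \<and> (B, (mfun M ^^ n) x) \<in> chi_star \<phi> M" for n
      proof (induction n)
        case 0
        show ?case
          using A Ax by auto
      next
        case (Suc n)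
        then obtain B where B: "B \<in> D" "(A, B) \<in> (I_arrows \<phi> \<inter> D \<times> D) ^^ n"
          "(B, (mfun M ^^ n) x) \<in> chi_star \<phi> M"
          by blast
        obtain C where "C \<in> D" "(B, C) \<in> I_arrows \<phi>" "(C, mfun M ((mfun M ^^ n) x)) \<in> chi_star \<phi> M"
          using follow[OF B(1,3)] by blast
        then show ?case
          using B by (intro bexI[of _ C]) auto
      qed
      have "x \<notin> truth_set M (Star \<psi>)"
        using nS chi(1)[OF Ax] subfms_subpm[OF \<psi>] by (auto simp: point_type_def)
      then obtain n where n: "(mfun M ^^ n) x \<notin> truth_set M \<psi>"
        using chi(2)[OF Ax] by auto
      obtain B where B: "B \<in> D" "(A, B) \<in> (I_arrows \<phi> \<inter> D \<times> D) ^^ n"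
        "(B, (mfun M ^^ n) x) \<in> chi_star \<phi> M"
        using path[of n] by blast
      have "\<psi> \<notin> I_type B"
        using n chi(1)[OF B(3)] by (auto simp: point_type_def)
      then show "\<exists>B\<in>D. \<exists>N. (A, B) \<in> (I_arrows \<phi> \<inter> D \<times> D) ^^ N \<and> neg \<psi> \<in> I_type B"
        using B(1,2) neg\<psi>[OF B(1)] by blast
    next
      assume "\<exists>B\<in>D. \<exists>N. (A, B) \<in> (I_arrows \<phi> \<inter> D \<times> D) ^^ N \<and> neg \<psi> \<in> I_type B"
      then obtain B n where B: "B \<in> D" and AB: "(A, B) \<in> (I_arrows \<phi> \<inter> D \<times> D) ^^ n"
        and nB: "\<psi> \<notin> I_type B"
        using neg\<psi> by blast
      have star_step: "Star \<psi> \<in> I_type C \<longleftrightarrow> \<psi> \<in> I_type C \<and> Star \<psi> \<in> I_type C'"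
        if "(C, C') \<in> I_arrows \<phi>" for C C'
        using sens[OF that] \<psi> unfolding sensible_pair_def by blast
      have "Star \<psi> \<in> I_type B" if "Star \<psi> \<in> I_type A"
        using AB
      proof (induction n arbitrary: B)
        case 0
        then show ?case
          using that by simp
      next
        case (Suc n)
        then obtain C where "(A, C) \<in> (I_arrows \<phi> \<inter> D \<times> D) ^^ n" "(C, B) \<in> I_arrows \<phi>"
          by auto
        then show ?case
          using Suc.IH star_step by blast
      qed
      \<comment> \<open>The \<open>Star\<close> clause of a sensible pair speaks of a source and its
        successor, so the failure of \<open>\<psi>\<close> at \<open>B\<close> can be used only once
        \<open>B\<close> has an outgoing arrow.\<close>
      moreover have "Star \<psi> \<notin> I_type B"
      proof -
        obtain x where "(B, x) \<in> chi_star \<phi> M"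
          using B by (auto simp: D_def)
        then obtain C where "(B, C) \<in> I_arrows \<phi>"
          using follow[OF B] by blast
        then show ?thesis
          using star_step nB by blast
      qed
      ultimately show "neg (Star \<psi>) \<in> I_type A"
        using negS[OF A] by blast
    qed
  qed
  ultimately have "quasimodel \<phi> ?Q"
    unfolding quasimodel_def omega_sensible_def using frame by (simp add: Q_simps)
  moreover have "satisfied_in \<phi> ?Q"
  proof -
    obtain x where x: "x \<in> truth_set M \<phi>"
      using assms(2) by blast
    then have "x \<in> topspace (mtop M)"
      using truth_set_subset[OF M] by blast
    then obtain b where b: "b \<in> fin_tree_frames \<phi>" "x \<in> simulated \<phi> M b"
      using finite_cover[OF M, of \<phi>] by (metis subsetD)
    have "\<phi> \<in> I_type (iso_class \<phi> b)"
      unfolding I_type_iso_class[OF b(1)] point_type_simulated[OF b(2), symmetric]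
      using x subfms_subpm[OF subfms_self] by (simp add: point_type_def)
    moreover have "iso_class \<phi> b \<in> D"
      using D_iff[OF b(1)] b(2) by blast
    ultimately show ?thesis
      unfolding satisfied_in_def Q_simps by blast
  qed
  ultimately show ?thesis
    by blast
qed

end
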